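(* Let $\nu\ge 0$, $T>0$, and let $(\mathbf u_h,p_h):[0,T]\to V_h^{1,c}\times V_h^{2,c}$ ($\mathbf u_h$ being $C^1$ in time) be a solution of the conforming semi-discrete incompressible Navier--Stokes scheme: for all $t$, $$\int_\Omega \frac{\partial \mathbf u_h}{\partial t}\cdot \mathbf v_h+\int_\Omega \mathbf u_h\cdot s_h(\mathbf u_h,\mathbf v_h)+\int_\Omega (\widetilde{\mathrm{grad}}_h\, p_h)\cdot \mathbf v_h+\nu\int_\Omega (\widetilde{\mathrm{curl}}_h\,\mathbf u_h)(\widetilde{\mathrm{curl}}_h\,\mathbf v_h)=0\quad\forall\,\mathbf v_h\in V_h^{1,c},$$ $$\int_\Omega \mathbf u_h\cdot s_h(\mathbf u_h,\widetilde{\mathrm{grad}}_h\, q_h)+\int_\Omega \widetilde{\mathrm{grad}}_h\, p_h\cdot\widetilde{\mathrm{grad}}_h\, q_h=0\quad\forall\, q_h\in V_h^{2,c}.$$ Then $\frac{\partial}{\partial t}\operatorname{div}(\mathbf u_h)=0$. Therefore, if $\operatorname{div}(\mathbf u_h(0))=0$, then $\operatorname{div}(\mathbf u_h(t))=0$ for all $t\ge 0$ (in the time interval of the solution).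
   Context: Setting (dimension $d=2$). $\Omega$ is a two-dimensional domain with either periodic boundary conditions (a rectangle with opposite sides identified; all function spaces are spaces of periodic functions: $V^0=H^1(\Omega)$, $V^1=H(\mathrm{div};\Omega)$, $V^2=L^2(\Omega)$) or homogeneous boundary conditions on a bounded Lipschitz domain ($V^0=H^1_0(\Omega)$, $V^1=H_0(\mathrm{div};\Omega)$, $V^2=L^2(\Omega)$). For scalar $\omega$, $\operatorname{curl}\omega=(\partial_2\omega,-\partial_1\omega)$. Discrete spaces: $V_h^{\ell,c}\subset V^\ell$, $\ell=0,1,2$, are finite-dimensional (finite element) spaces of bounded functions with $\operatorname{curl}V_h^{0,c}\subset V_h^{1,c}$ and $\operatorname{div}V_h^{1,c}\subset V_h^{2,c}$ (and there are projections $\Pi_\ell:V^\ell\to V_h^{\ell,c}$ with $\operatorname{curl}\Pi_0=\Pi_1\operatorname{curl}$ and $\operatorname{div}\Pi_1=\Pi_2\operatorname{div}$). Discrete dual operators: $\widetilde{\mathrm{grad}}_h:V_h^{2,c}\to V_h^{1,c}$ and $\widetilde{\mathrm{curl}}_h:V_h^{1,c}\to V_h^{0,c}$ are defined by $\int_\Omega \widetilde{\mathrm{grad}}_h q_h\cdot\mathbf v_h=-\int_\Omega q_h\operatorname{div}\mathbf v_h$ and $\int_\Omega(\widetilde{\mathrm{curl}}_h\mathbf v_h)\,\omega_h=\int_\Omega\mathbf v_h\cdot\operatorname{curl}\omega_h$ for all $q_h\in V_h^{2,c}$, $\mathbf v_h\in V_h^{1,c}$, $\omega_h\in V_h^{0,c}$.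 Discrete interior product: for a vector $\mathbf a\in\mathbb R^2$, $\tilde\imath^{0h}_{\mathbf a}\mathbf u_h=\tilde P_h^0(\mathbf a\cdot\mathbf u_h)$, with $\tilde P_h^0$ the $L^2$-orthogonal projection onto $V_h^{2,c}$. With $\mathbf e_1,\mathbf e_2$ the canonical basis and $P_h^1$ the $L^2$-orthogonal projection onto $V_h^{1,c}$, $$s_h(\mathbf u_h,\mathbf v_h)=\tfrac12P_h^1\Big(\sum_{k=1}^{2}(\tilde\imath^{0h}_{\mathbf e_k}\mathbf v_h)\,\widetilde{\mathrm{grad}}_h(\tilde\imath^{0h}_{\mathbf e_k}\mathbf u_h)-(\tilde\imath^{0h}_{\mathbf e_k}\mathbf u_h)\,\widetilde{\mathrm{grad}}_h(\tilde\imath^{0h}_{\mathbf e_k}\mathbf v_h)\Big).$$ *)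

theory Defs
  imports "HOL-Analysis.Analysis"
begin

section \<open>Lebesgue spaces\<close>

text \<open>
  Elements of function spaces are represented by functions on the whole plane of which only the
  values in the open set \<open>\<Omega>\<close> matter; two of them represent the same element iff they agree
  almost everywhere in \<open>\<Omega>\<close>.
\<close>

definition ae_eq :: "(real^2) set \<Rightarrow> (real^2 \<Rightarrow> 'b) \<Rightarrow> (real^2 \<Rightarrow> 'b) \<Rightarrow> bool" where
  "ae_eq \<Omega> f g \<longleftrightarrow> (AE x in lebesgue_on \<Omega>. f x = g x)"

definition L2 :: "(real^2) set \<Rightarrow> (real^2 \<Rightarrow> 'b::euclidean_space) set" where
  "L2 \<Omega> = {f. f \<in> borel_measurable (lebesgue_on \<Omega>) \<and>
               integrable (lebesgue_on \<Omega>) (\<lambda>x. (norm (f x))\<^sup>2)}"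

definition l2_inner :: "(real^2) set \<Rightarrow> (real^2 \<Rightarrow> 'b::euclidean_space) \<Rightarrow> (real^2 \<Rightarrow> 'b) \<Rightarrow> real" where
  "l2_inner \<Omega> f g = (LINT x|lebesgue_on \<Omega>. f x \<bullet> g x)"

definition l2_norm :: "(real^2) set \<Rightarrow> (real^2 \<Rightarrow> 'b::euclidean_space) \<Rightarrow> real" where
  "l2_norm \<Omega> f = sqrt (l2_inner \<Omega> f f)"


section \<open>Domains and boundary conditions\<close>

text \<open>Near each boundary point the set is, in suitable orthogonal coordinates, the strict
  epigraph of a Lipschitz function.\<close>

definition lipschitz_boundary :: "(real^2) set \<Rightarrow> bool" where
  "lipschitz_boundary \<Omega> \<longleftrightarrow>
     (\<forall>z\<in>frontier \<Omega>. \<exists>r>0. \<exists>R :: real^2 \<Rightarrow> real^2. \<exists>\<gamma> :: real \<Rightarrow> real. \<exists>L.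
        orthogonal_transformation R \<and> L-lipschitz_on UNIV \<gamma> \<and>
        \<Omega> \<inter> ball z r = {x \<in> ball z r. \<gamma> (R x $ 1) < R x $ 2})"

text \<open>
  \<open>Periodic a b\<close> is the rectangle with opposite corners \<open>a\<close>, \<open>b\<close> and opposite sides identified;
  functions on it are given by their values in the open cell. \<open>Homogeneous \<Omega>\<close> is \<open>\<Omega>\<close> with
  homogeneous boundary conditions.
\<close>

datatype flow_domain = Periodic "real^2" "real^2" | Homogeneous "(real^2) set"

fun region :: "flow_domain \<Rightarrow> (real^2) set" where
  "region (Periodic a b) = box a b"
| "region (Homogeneous \<Omega>) = \<Omega>"

fun valid_domain :: "flow_domain \<Rightarrow> bool" where
  "valid_domain (Periodic a b) \<longleftrightarrow> (\<forall>i. a $ i < b $ i)"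
| "valid_domain (Homogeneous \<Omega>) \<longleftrightarrow>
     open \<Omega> \<and> connected \<Omega> \<and> bounded \<Omega> \<and> \<Omega> \<noteq> {} \<and> lipschitz_boundary \<Omega>"


section \<open>Test functions\<close>

definition pderiv_at :: "2 \<Rightarrow> (real^2 \<Rightarrow> real) \<Rightarrow> real^2 \<Rightarrow> real" where
  "pderiv_at i f x = frechet_derivative f (at x) (axis i 1)"

primrec Ck :: "nat \<Rightarrow> (real^2 \<Rightarrow> real) \<Rightarrow> bool" where
  "Ck 0 f \<longleftrightarrow> continuous_on UNIV f"
| "Ck (Suc k) f \<longleftrightarrow> (\<forall>x. f differentiable (at x)) \<and> (\<forall>i. Ck k (pderiv_at i f))"

text \<open>Smooth periodic functions in the periodic case; smooth functions with compact support in
  \<open>\<Omega>\<close> in the homogeneous case.\<close>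

fun test_functions :: "flow_domain \<Rightarrow> (real^2 \<Rightarrow> real) set" where
  "test_functions (Periodic a b) =
     {\<phi>. (\<forall>k. Ck k \<phi>) \<and> (\<forall>i x. \<phi> (x + axis i (b $ i - a $ i)) = \<phi> x)}"
| "test_functions (Homogeneous \<Omega>) =
     {\<phi>. (\<forall>k. Ck k \<phi>) \<and> compact (closure {x. \<phi> x \<noteq> 0}) \<and> closure {x. \<phi> x \<noteq> 0} \<subseteq> \<Omega>}"


section \<open>Weak derivatives and the continuous complex\<close>

definition is_weak_pderiv :: "flow_domain \<Rightarrow> 2 \<Rightarrow> (real^2 \<Rightarrow> real) \<Rightarrow> (real^2 \<Rightarrow> real) \<Rightarrow> bool" where
  "is_weak_pderiv D i f g \<longleftrightarrow> g \<in> L2 (region D) \<and>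
     (\<forall>\<phi>\<in>test_functions D. l2_inner (region D) f (pderiv_at i \<phi>) = - l2_inner (region D) g \<phi>)"

definition is_weak_div :: "flow_domain \<Rightarrow> (real^2 \<Rightarrow> real^2) \<Rightarrow> (real^2 \<Rightarrow> real) \<Rightarrow> bool" where
  "is_weak_div D v d \<longleftrightarrow> d \<in> L2 (region D) \<and>
     (\<forall>\<phi>\<in>test_functions D.
        l2_inner (region D) v (\<lambda>x. \<chi> i. pderiv_at i \<phi> x) = - l2_inner (region D) d \<phi>)"

text \<open>The weak derivatives below are unique up to null sets; \<open>SOME\<close> picks a representative.\<close>

definition weak_pderiv :: "flow_domain \<Rightarrow> 2 \<Rightarrow> (real^2 \<Rightarrow> real) \<Rightarrow> real^2 \<Rightarrow> real" where
  "weak_pderiv D i f = (SOME g. is_weak_pderiv D i f g)"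

definition weak_div :: "flow_domain \<Rightarrow> (real^2 \<Rightarrow> real^2) \<Rightarrow> real^2 \<Rightarrow> real" where
  "weak_div D v = (SOME d. is_weak_div D v d)"

definition weak_curl :: "flow_domain \<Rightarrow> (real^2 \<Rightarrow> real) \<Rightarrow> real^2 \<Rightarrow> real^2" where
  "weak_curl D \<omega> = (\<lambda>x. vector [weak_pderiv D 2 \<omega> x, - weak_pderiv D 1 \<omega> x])"

definition H1 :: "flow_domain \<Rightarrow> (real^2 \<Rightarrow> real) set" where
  "H1 D = {f \<in> L2 (region D). \<forall>i. \<exists>g. is_weak_pderiv D i f g}"

definition Hdiv :: "flow_domain \<Rightarrow> (real^2 \<Rightarrow> real^2) set" where
  "Hdiv D = {v \<in> L2 (region D). \<exists>d. is_weak_div D v d}"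

text \<open>With homogeneous boundary conditions the first two spaces are the closures of the compactly
  supported smooth functions and fields in \<open>H1\<close> and \<open>Hdiv\<close>.\<close>

fun V0 :: "flow_domain \<Rightarrow> (real^2 \<Rightarrow> real) set" where
  "V0 (Periodic a b) = H1 (Periodic a b)"
| "V0 (Homogeneous \<Omega>) =
     {f \<in> H1 (Homogeneous \<Omega>). \<exists>\<Phi> :: nat \<Rightarrow> real^2 \<Rightarrow> real.
        (\<forall>n. \<Phi> n \<in> test_functions (Homogeneous \<Omega>)) \<and>
        (\<lambda>n. l2_norm \<Omega> (\<lambda>x. \<Phi> n x - f x)) \<longlonglongrightarrow> 0 \<and>
        (\<forall>i. (\<lambda>n. l2_norm \<Omega> (\<lambda>x. pderiv_at i (\<Phi> n) x - weak_pderiv (Homogeneous \<Omega>) i f x)) \<longlonglongrightarrow> 0)}"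

fun V1 :: "flow_domain \<Rightarrow> (real^2 \<Rightarrow> real^2) set" where
  "V1 (Periodic a b) = Hdiv (Periodic a b)"
| "V1 (Homogeneous \<Omega>) =
     {v \<in> Hdiv (Homogeneous \<Omega>). \<exists>\<Phi> :: nat \<Rightarrow> real^2 \<Rightarrow> real^2.
        (\<forall>n i. (\<lambda>x. \<Phi> n x $ i) \<in> test_functions (Homogeneous \<Omega>)) \<and>
        (\<lambda>n. l2_norm \<Omega> (\<lambda>x. \<Phi> n x - v x)) \<longlonglongrightarrow> 0 \<and>
        (\<lambda>n. l2_norm \<Omega> (\<lambda>x. (\<Sum>i\<in>UNIV. pderiv_at i (\<lambda>y. \<Phi> n y $ i) x)
                                 - weak_div (Homogeneous \<Omega>) v x)) \<longlonglongrightarrow> 0}"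

definition V2 :: "flow_domain \<Rightarrow> (real^2 \<Rightarrow> real) set" where
  "V2 D = L2 (region D)"


section \<open>Discrete spaces\<close>

text \<open>
  A finite-dimensional space of (essentially) bounded functions inside \<open>V\<close>. The set contains
  all representatives of each of its elements, so its dimension is finite only modulo equality
  almost everywhere.
\<close>

definition discrete_space ::
    "(real^2) set \<Rightarrow> (real^2 \<Rightarrow> 'b::euclidean_space) set \<Rightarrow> (real^2 \<Rightarrow> 'b) set \<Rightarrow> bool" where
  "discrete_space \<Omega> V W \<longleftrightarrow>
     W \<subseteq> V \<and>
     (\<lambda>x. 0) \<in> W \<and>
     (\<forall>f\<in>W. \<forall>g\<in>W. \<forall>\<alpha> \<beta>. (\<lambda>x. \<alpha> *\<^sub>R f x + \<beta> *\<^sub>R g x) \<in> W) \<and>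
     (\<forall>f\<in>W. \<forall>g. ae_eq \<Omega> f g \<longrightarrow> g \<in> W) \<and>
     (\<exists>B. finite B \<and> B \<subseteq> W \<and> (\<forall>f\<in>W. \<exists>c. ae_eq \<Omega> f (\<lambda>x. \<Sum>b\<in>B. c b *\<^sub>R b x))) \<and>
     (\<forall>f\<in>W. \<exists>C. AE x in lebesgue_on \<Omega>. norm (f x) \<le> C)"

definition is_projection ::
    "(real^2) set \<Rightarrow> (real^2 \<Rightarrow> 'b::euclidean_space) set \<Rightarrow> (real^2 \<Rightarrow> 'b) set \<Rightarrow>
     ((real^2 \<Rightarrow> 'b) \<Rightarrow> real^2 \<Rightarrow> 'b) \<Rightarrow> bool" where
  "is_projection \<Omega> V W P \<longleftrightarrow>
     (\<forall>f\<in>V. P f \<in> W) \<and>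
     (\<forall>f\<in>W. ae_eq \<Omega> (P f) f) \<and>
     (\<forall>f\<in>V. \<forall>g\<in>V. ae_eq \<Omega> f g \<longrightarrow> ae_eq \<Omega> (P f) (P g)) \<and>
     (\<forall>f\<in>V. \<forall>g\<in>V. \<forall>\<alpha> \<beta>. ae_eq \<Omega> (P (\<lambda>x. \<alpha> *\<^sub>R f x + \<beta> *\<^sub>R g x))
                                     (\<lambda>x. \<alpha> *\<^sub>R P f x + \<beta> *\<^sub>R P g x))"

definition discrete_complex ::
    "flow_domain \<Rightarrow> (real^2 \<Rightarrow> real) set \<Rightarrow> (real^2 \<Rightarrow> real^2) set \<Rightarrow> (real^2 \<Rightarrow> real) set \<Rightarrow> bool" where
  "discrete_complex D W0 W1 W2 \<longleftrightarrow>
     discrete_space (region D) (V0 D) W0 \<and>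
     discrete_space (region D) (V1 D) W1 \<and>
     discrete_space (region D) (V2 D) W2 \<and>
     weak_curl D ` W0 \<subseteq> W1 \<and>
     weak_div D ` W1 \<subseteq> W2 \<and>
     (\<exists>P0 P1 P2.
        is_projection (region D) (V0 D) W0 P0 \<and>
        is_projection (region D) (V1 D) W1 P1 \<and>
        is_projection (region D) (V2 D) W2 P2 \<and>
        (\<forall>\<omega>\<in>V0 D. ae_eq (region D) (weak_curl D (P0 \<omega>)) (P1 (weak_curl D \<omega>))) \<and>
        (\<forall>v\<in>V1 D. ae_eq (region D) (weak_div D (P1 v)) (P2 (weak_div D v))))"


section \<open>Discrete operators\<close>

text \<open>The functions chosen here are unique up to null sets when the spaces form a
  \<open>discrete_complex\<close>.\<close>

definition grad_h :: "flow_domain \<Rightarrow> (real^2 \<Rightarrow> real^2) set \<Rightarrow> (real^2 \<Rightarrow> real) \<Rightarrow> real^2 \<Rightarrow> real^2" where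
  "grad_h D W1 q = (SOME g. g \<in> W1 \<and>
     (\<forall>v\<in>W1. l2_inner (region D) g v = - l2_inner (region D) q (weak_div D v)))"

definition curl_h :: "flow_domain \<Rightarrow> (real^2 \<Rightarrow> real) set \<Rightarrow> (real^2 \<Rightarrow> real^2) \<Rightarrow> real^2 \<Rightarrow> real" where
  "curl_h D W0 v = (SOME w. w \<in> W0 \<and>
     (\<forall>\<omega>\<in>W0. l2_inner (region D) w \<omega> = l2_inner (region D) v (weak_curl D \<omega>)))"

definition l2_proj ::
    "(real^2) set \<Rightarrow> (real^2 \<Rightarrow> 'b::euclidean_space) set \<Rightarrow> (real^2 \<Rightarrow> 'b) \<Rightarrow> real^2 \<Rightarrow> 'b" where
  "l2_proj \<Omega> W f = (SOME g. g \<in> W \<and> (\<forall>z\<in>W. l2_inner \<Omega> g z = l2_inner \<Omega> f z))"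

definition interior_prod_h ::
    "flow_domain \<Rightarrow> (real^2 \<Rightarrow> real) set \<Rightarrow> real^2 \<Rightarrow> (real^2 \<Rightarrow> real^2) \<Rightarrow> real^2 \<Rightarrow> real" where
  "interior_prod_h D W2 a u = l2_proj (region D) W2 (\<lambda>x. a \<bullet> u x)"

definition s_h ::
    "flow_domain \<Rightarrow> (real^2 \<Rightarrow> real^2) set \<Rightarrow> (real^2 \<Rightarrow> real) set \<Rightarrow>
     (real^2 \<Rightarrow> real^2) \<Rightarrow> (real^2 \<Rightarrow> real^2) \<Rightarrow> real^2 \<Rightarrow> real^2" where
  "s_h D W1 W2 u v = (\<lambda>x. (1/2) *\<^sub>R l2_proj (region D) W1
     (\<lambda>y. \<Sum>k\<in>UNIV.
        interior_prod_h D W2 (axis k 1) v y *\<^sub>R grad_h D W1 (interior_prod_h D W2 (axis k 1) u) y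
      - interior_prod_h D W2 (axis k 1) u y *\<^sub>R grad_h D W1 (interior_prod_h D W2 (axis k 1) v) y) x)"


section \<open>Time derivatives\<close>

text \<open>Derivatives and continuity in time are taken in \<open>L2\<close>; on a finite-dimensional space all
  norms give the same notion. They are one-sided at the end points of \<open>[0, T]\<close>.\<close>

definition has_time_derivative ::
    "(real^2) set \<Rightarrow> real \<Rightarrow> (real \<Rightarrow> real^2 \<Rightarrow> 'b::euclidean_space) \<Rightarrow> (real^2 \<Rightarrow> 'b) \<Rightarrow> real \<Rightarrow> bool" where
  "has_time_derivative \<Omega> T u w t \<longleftrightarrow>
     ((\<lambda>s. l2_norm \<Omega> (\<lambda>x. (1 / (s - t)) *\<^sub>R (u s x - u t x) - w x)) \<longlongrightarrow> 0) (at t within {0..T})"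

definition l2_continuous ::
    "(real^2) set \<Rightarrow> real \<Rightarrow> (real \<Rightarrow> real^2 \<Rightarrow> 'b::euclidean_space) \<Rightarrow> bool" where
  "l2_continuous \<Omega> T u \<longleftrightarrow>
     (\<forall>t\<in>{0..T}. ((\<lambda>s. l2_norm \<Omega> (\<lambda>x. u s x - u t x)) \<longlongrightarrow> 0) (at t within {0..T}))"

end

theory Submission
  imports Defs
begin

text \<open>
  Test the momentum equation with \<open>v = grad_h q\<close> and subtract the pressure equation. The viscous term
  drops out because \<open>curl_h (grad_h q)\<close> vanishes: it is the discrete adjoint of
  \<open>div (curl \<omega>) = 0\<close>. What remains is \<open>\<langle>u', grad_h q\<rangle> = - \<langle>div u', q\<rangle> = 0\<close> for all \<open>q\<close>, and
  \<open>q = div u'\<close> gives \<open>div u' = 0\<close>. Time derivative and divergence commute because the divergence is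
  bounded on the finite-dimensional space of velocities.

  The weak divergence is determined up to null sets, and linear, because the test functions
  separate square integrable functions: \<open>exp (- 1 / (n r))\<close>, with \<open>r\<close> positive exactly on an interval, converges to the indicator
  function of that interval, so products of two such functions approximate indicators of boxes.
\<close>

section \<open>Smooth bump functions\<close>

text \<open>Functions stand for their classes modulo null sets, and the discrete operators and weak
  derivatives are picked by \<open>SOME\<close>. Nothing can be said about \<open>weak_div\<close>
  or \<open>grad_h\<close> before existence and uniqueness up to null sets are established, and this
  shapes the development: uniqueness of the divergence needs the bump functions, existence of
  \<open>grad_h\<close> needs a Riesz representation. Since the discrete spaces contain all
  representatives, bases exist only modulo null sets; Gram-Schmidt is carried out in that sense. The
  same orthonormal basis bounds the divergence through its adjoint: the coefficient of
  \<open>div v\<close> along \<open>e\<close> is that of \<open>v\<close> along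
  \<open>- grad_h e\<close>, so Parseval and Cauchy-Schwarz give the bound
  \<open>sqrt (sum of the squared norms of grad_h e)\<close>. The convective term enters both
  equations as the same number and cancels in the subtraction. A zero time derivative holds in the
  L2 sense only, so constancy is obtained from scalar functions of time, by pairing with a fixed
  function of space.\<close>

text \<open>The one-variable counterpart of \<open>Ck\<close>; \<open>Ck_tensor\<close> carries it
  over to products of functions of one coordinate each.\<close>

primrec C_real :: "nat \<Rightarrow> (real \<Rightarrow> real) \<Rightarrow> bool" where
  "C_real 0 f \<longleftrightarrow> continuous_on UNIV f"
| "C_real (Suc k) f \<longleftrightarrow> (\<forall>x. f differentiable (at x)) \<and> C_real k (deriv f)"

lemma C_real_SucI:
  assumes "\<And>x. (f has_real_derivative f' x) (at x)" "C_real k f'"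
  shows "C_real (Suc k) f"
proof -
  have "deriv f = f'"
    using assms(1) by (auto intro: DERIV_imp_deriv)
  then show ?thesis
    using assms real_differentiable_def by auto
qed

lemma C_real_SucD:
  assumes "C_real (Suc k) f"
  shows "(f has_real_derivative deriv f x) (at x)" "C_real k (deriv f)"
  using assms DERIV_deriv_iff_real_differentiable by auto

lemma C_real_continuous: "C_real k f \<Longrightarrow> continuous_on UNIV f"
  by (cases k) (auto intro!: continuous_at_imp_continuous_on differentiable_imp_continuous_within)

text \<open>The product and chain rules leave an undifferentiated function behind, which the
  induction hypotheses want at one order lower.\<close>

lemma C_real_pred: "C_real (Suc k) f \<Longrightarrow> C_real k f"
proof (induction k arbitrary: f)
  case 0
  show ?case using C_real_continuous[OF 0] by simp
next
  case (Suc k)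
  then show ?case by (meson C_real.simps(2))
qed

lemma C_real_const: "C_real k (\<lambda>x. c)"
proof (induction k arbitrary: c)
  case (Suc k)
  show ?case by (rule C_real_SucI[where f' = "\<lambda>x. 0"]) (auto intro: Suc)
qed simp

lemma C_real_id: "C_real k (\<lambda>x. x)"
proof (cases k)
  case (Suc m)
  show ?thesis unfolding Suc
    by (rule C_real_SucI[where f' = "\<lambda>x. 1"]) (auto intro: C_real_const)
qed simp

lemma C_real_add: "C_real k f \<Longrightarrow> C_real k g \<Longrightarrow> C_real k (\<lambda>x. f x + g x)"
proof (induction k arbitrary: f g)
  case (Suc k)
  show ?case
    by (rule C_real_SucI[where f' = "\<lambda>x. deriv f x + deriv g x"])
      (auto intro!: DERIV_add Suc.IH C_real_SucD[OF Suc.prems(1)] C_real_SucD[OF Suc.prems(2)])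
qed (auto intro: continuous_intros)

lemma C_real_mult: "C_real k f \<Longrightarrow> C_real k g \<Longrightarrow> C_real k (\<lambda>x. f x * g x)"
proof (induction k arbitrary: f g)
  case (Suc k)
  show ?case
    by (rule C_real_SucI[where f' = "\<lambda>x. deriv f x * g x + deriv g x * f x"])
      (auto intro!: DERIV_mult C_real_add Suc.IH C_real_pred[OF Suc.prems(1)] C_real_pred[OF Suc.prems(2)]
        C_real_SucD[OF Suc.prems(1)] C_real_SucD[OF Suc.prems(2)])
qed (auto intro: continuous_intros)

lemma C_real_diff: "C_real k f \<Longrightarrow> C_real k g \<Longrightarrow> C_real k (\<lambda>x. f x - g x)"
  using C_real_add[OF _ C_real_mult[OF C_real_const[of k "-1"]], of f g] by simp

lemma C_real_compose: "C_real k f \<Longrightarrow> C_real k g \<Longrightarrow> C_real k (\<lambda>x. f (g x))"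
proof (induction k arbitrary: f g)
  case 0
  then show ?case
    using continuous_on_compose2[of UNIV f UNIV g] by simp
next
  case (Suc k)
  note f = C_real_SucD[OF Suc.prems(1)] and g = C_real_SucD[OF Suc.prems(2)]
  show ?case
    by (rule C_real_SucI[OF DERIV_chain2[OF f(1) g(1)]
          C_real_mult[OF Suc.IH[OF f(2) C_real_pred[OF Suc.prems(2)]] g(2)]])
qed

text \<open>Each function is, up to sign, the derivative of the other, so a single induction has to
  carry both.\<close>

lemma C_real_sin_cos: "C_real k sin \<and> C_real k cos"
proof (induction k)
  case (Suc k)
  have "C_real k (\<lambda>x. - 1 * sin x)"
    using C_real_mult[OF C_real_const] Suc by blast
  then show ?case
    using Suc by (auto intro!: C_real_SucI[of sin cos] C_real_SucI[of cos "\<lambda>x. - 1 * sin x"]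
        derivative_eq_intros simp del: C_real.simps)
qed (auto intro: continuous_intros)

text \<open>For \<open>j = 0\<close> this is the classical smooth function that is flat at 0. The
  powers in the denominator close the family under differentiation up to linear combinations, so
  smoothness follows by one induction over all \<open>j\<close>.\<close>

definition flat_fn :: "nat \<Rightarrow> real \<Rightarrow> real" where
  "flat_fn j x = (if x \<le> 0 then 0 else exp (- (1 / x)) / x ^ j)"

text \<open>From the right, with \<open>y = 1 / x\<close>, this is the decay of
  \<open>y ^ j / exp y\<close> at infinity.\<close>

lemma flat_fn_tendsto_0: "((\<lambda>x. flat_fn j x) \<longlongrightarrow> 0) (at 0)"
proof -
  have "((\<lambda>y::real. y ^ j / exp y) \<longlongrightarrow> 0) at_top"
    by (rule tendsto_power_div_exp_0)
  then have "((\<lambda>x::real. (inverse x) ^ j / exp (inverse x)) \<longlongrightarrow> 0) (at_right 0)"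
    by (rule filterlim_compose) (rule filterlim_inverse_at_top_right)
  moreover have "\<forall>\<^sub>F x in at_right 0. (inverse x) ^ j / exp (inverse x) = flat_fn j x"
    using eventually_at_right_less[of "0::real"]
    by eventually_elim (auto simp: flat_fn_def exp_minus field_simps)
  ultimately have r: "(flat_fn j \<longlongrightarrow> 0) (at_right 0)"
    by (rule Lim_transform_eventually)
  have "\<forall>\<^sub>F x in at_left 0. 0 = flat_fn j x"
    by (auto simp: flat_fn_def eventually_at_filter)
  then have l: "(flat_fn j \<longlongrightarrow> 0) (at_left 0)"
    by (rule Lim_transform_eventually[OF tendsto_const])
  show ?thesis using l r filterlim_split_at by blast
qed

lemma flat_fn_deriv:
  "(flat_fn j has_real_derivative flat_fn (j + 2) x - real j * flat_fn (j + 1) x) (at x)"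
proof -
  consider "x < 0" | "x = 0" | "x > 0" by linarith
  then show ?thesis
  proof cases
    case 1
    have "((\<lambda>x. 0) has_real_derivative 0) (at x)" by simp
    moreover have "\<forall>\<^sub>F y in nhds x. 0 = flat_fn j y"
      using eventually_nhds_in_open[of "{..<0}" x] 1
      by (auto elim!: eventually_mono simp: flat_fn_def)
    ultimately show ?thesis
      using 1 by (subst DERIV_cong_ev[where g = "\<lambda>x. 0"]) (auto simp: flat_fn_def elim: eventually_mono)
  next
    case 2
    \<comment> \<open>The difference quotient at 0 is the next member of the family, even at
      \<open>h = 0\<close>, where division by zero makes both sides 0.\<close>
    have "(\<lambda>h. (flat_fn j (0 + h) - flat_fn j 0) / h) = flat_fn (Suc j)"
      by (auto simp: fun_eq_iff flat_fn_def)
    moreover have "flat_fn (j + 2) x - real j * flat_fn (j + 1) x = 0"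
      using 2 by (simp add: flat_fn_def)
    ultimately show ?thesis
      using flat_fn_tendsto_0[of "Suc j"] unfolding DERIV_def 2 by simp
  next
    case 3
    have "((\<lambda>x. exp (- (1 / x)) * inverse (x ^ j)) has_real_derivative
        flat_fn (j + 2) x - real j * flat_fn (j + 1) x) (at x)"
    proof -
      have "((\<lambda>x. - (1 / x)) has_real_derivative 1 / x ^ 2) (at x)"
        using 3 by (auto intro!: derivative_eq_intros simp: power2_eq_square)
      then have e: "((\<lambda>x. exp (- (1 / x))) has_real_derivative exp (- (1 / x)) * (1 / x ^ 2)) (at x)"
        by (rule DERIV_fun_exp)
      have p: "((\<lambda>x. inverse (x ^ j)) has_real_derivative - real j / x ^ (j + 1)) (at x)"
      \<comment> \<open>The power rule produces the truncated exponent \<open>j - Suc 0\<close>;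
        cancelling it against the denominator requires \<open>j\<close> to be a successor. For
        \<open>j = 0\<close> the function is constant.\<close>
      proof (cases j)
        case (Suc m)
        have "- (real j * x ^ (j - Suc 0) * inverse ((x ^ j) ^ Suc (Suc 0))) = - real j / x ^ (j + 1)"
          using 3 unfolding Suc by (simp add: field_simps)
        then show ?thesis
          using DERIV_inverse_fun[OF DERIV_pow[of j x UNIV]] 3 by simp
      qed simp
      have "exp (- (1 / x)) * (1 / x ^ 2) * inverse (x ^ j) + - real j / x ^ (j + 1) * exp (- (1 / x)) =
          flat_fn (j + 2) x - real j * flat_fn (j + 1) x"
        using 3 by (simp add: flat_fn_def divide_inverse power2_eq_square mult.assoc)
      then show ?thesis using DERIV_mult[OF e p] by simp
    qed
    moreover have "\<forall>\<^sub>F y in nhds x. flat_fn j y = exp (- (1 / y)) * inverse (y ^ j)"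
      by (rule eventually_mono[OF eventually_nhds_in_open[of "{0<..}" x]])
        (use 3 in \<open>auto simp: flat_fn_def divide_inverse\<close>)
    ultimately show ?thesis
      by (subst DERIV_cong_ev) auto
  qed
qed

lemma C_real_flat_fn: "C_real k (flat_fn j)"
proof (induction k arbitrary: j)
  case 0
  show ?case
    using flat_fn_deriv[of j] by (auto intro: continuous_at_imp_continuous_on DERIV_isCont)
next
  case (Suc k)
  show ?case
    by (rule C_real_SucI[OF flat_fn_deriv]) (intro C_real_diff C_real_mult C_real_const Suc)
qed

lemma flat_fn_scaled_tendsto:
  "(\<lambda>n. flat_fn 0 (real (Suc n) * r)) \<longlonglongrightarrow> (if r > 0 then 1 else 0)"
proof (cases "r > 0")
  case True
  have "(\<lambda>n. exp (- (inverse r * inverse (real (Suc n))))) \<longlonglongrightarrow> exp (- (inverse r * 0))"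
    by (intro tendsto_intros LIMSEQ_inverse_real_of_nat)
  \<comment> \<open>\<open>Suc n\<close> keeps the scaling positive: with factor 0 the left side
    would be 0, but the right side 1 because \<open>inverse 0 = 0\<close>.\<close>
  moreover have "flat_fn 0 (real (Suc n) * r) = exp (- (inverse r * inverse (real (Suc n))))" for n
    using True by (simp add: flat_fn_def divide_simps mult_le_0_iff del: of_nat_Suc)
  ultimately show ?thesis using True by simp
next
  case False
  then have "flat_fn 0 (real (Suc n) * r) = 0" for n
    by (simp add: flat_fn_def mult_nonneg_nonpos del: of_nat_Suc)
  then show ?thesis using False by simp
qed

lemma flat_fn_bounds: "0 \<le> flat_fn 0 x" "flat_fn 0 x \<le> 1"
  by (auto simp: flat_fn_def)

section \<open>Tensor-product test functions\<close>

lemma tensor_has_derivative: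
  assumes "\<And>x. (f has_real_derivative f' x) (at x)" "\<And>x. (g has_real_derivative g' x) (at x)"
  shows "((\<lambda>x::real^2. f (x $ 1) * g (x $ 2)) has_derivative
    (\<lambda>h. f' (x $ 1) * h $ 1 * g (x $ 2) + f (x $ 1) * (g' (x $ 2) * h $ 2))) (at x)"
proof -
  have 1: "((\<lambda>x::real^2. f (x $ 1)) has_derivative (\<lambda>h. f' (x $ 1) * h $ 1)) (at x)"
    using has_derivative_compose[where f = "\<lambda>x::real^2. x $ 1" and f' = "\<lambda>h. h $ 1" and g = f]
      assms(1)[of "x $ 1"] by (auto simp: has_field_derivative_def bounded_linear_imp_has_derivative bounded_linear_vec_nth)
  have 2: "((\<lambda>x::real^2. g (x $ 2)) has_derivative (\<lambda>h. g' (x $ 2) * h $ 2)) (at x)"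
    using has_derivative_compose[where f = "\<lambda>x::real^2. x $ 2" and f' = "\<lambda>h. h $ 2" and g = g]
      assms(2)[of "x $ 2"] by (auto simp: has_field_derivative_def bounded_linear_imp_has_derivative bounded_linear_vec_nth)
  show ?thesis
    by (rule has_derivative_eq_rhs[OF has_derivative_mult[OF 1 2]]) (auto simp: algebra_simps)
qed

lemma tensor_pderiv_at:
  assumes "\<And>x. (f has_real_derivative f' x) (at x)" "\<And>x. (g has_real_derivative g' x) (at x)"
  shows "pderiv_at 1 (\<lambda>x. f (x $ 1) * g (x $ 2)) = (\<lambda>x. f' (x $ 1) * g (x $ 2))"
    and "pderiv_at 2 (\<lambda>x. f (x $ 1) * g (x $ 2)) = (\<lambda>x. f (x $ 1) * g' (x $ 2))"
  unfolding pderiv_at_def frechet_derivative_at[OF tensor_has_derivative[OF assms], symmetric]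
  by (simp_all add: axis_def fun_eq_iff)

lemma Ck_tensor: "C_real k f \<Longrightarrow> C_real k g \<Longrightarrow> Ck k (\<lambda>x. f (x $ 1) * g (x $ 2))"
proof (induction k arbitrary: f g)
  case 0
  have "continuous_on UNIV (\<lambda>x::real^2. f (x $ 1))" "continuous_on UNIV (\<lambda>x::real^2. g (x $ 2))"
    using 0 by (auto intro!: continuous_on_compose2[of UNIV f] continuous_on_compose2[of UNIV g] continuous_intros)
  then show ?case by (auto intro!: continuous_intros)
next
  case (Suc k)
  note f = C_real_SucD[OF Suc.prems(1)] and g = C_real_SucD[OF Suc.prems(2)]
  have "(\<lambda>x::real^2. f (x $ 1) * g (x $ 2)) differentiable (at x)" for x
    using tensor_has_derivative[OF f(1) g(1)] by (auto simp: differentiable_def)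
  then show ?case
    using Suc.IH f(2) g(2) C_real_pred[OF Suc.prems(1)] C_real_pred[OF Suc.prems(2)]
    by (auto simp: forall_2 tensor_pderiv_at[OF f(1) g(1)])
qed

text \<open>In \<open>weak_div_weak_curl\<close> the weak derivatives are tested against partial
  derivatives of test functions. The support does not grow, since the derivative vanishes on the
  open complement of the old support.\<close>

lemma pderiv_at_test_function:
  assumes "\<phi> \<in> test_functions D"
  shows "pderiv_at i \<phi> \<in> test_functions D"
proof (cases D)
  case (Periodic a b)
  have Ck: "\<And>k. Ck k \<phi>" and per: "\<And>j x. \<phi> (x + axis j (b $ j - a $ j)) = \<phi> x"
    using assms Periodic by auto
  have C: "Ck k (pderiv_at i \<phi>)" for k using Ck[of "Suc k"] by auto
  have d: "(\<phi> has_derivative frechet_derivative \<phi> (at x)) (at x)" for x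
    using Ck[of "Suc 0"] frechet_derivative_works by auto
  have "pderiv_at i \<phi> (x + axis j (b $ j - a $ j)) = pderiv_at i \<phi> x" for j x
  proof -
    let ?v = "axis j (b $ j - a $ j)"
    \<comment> \<open>By periodicity this translate is \<phi> itself, so uniqueness of the
      derivative at \<open>x\<close> equates the derivatives at the two points.\<close>
    have "((\<lambda>y. \<phi> (y + ?v)) has_derivative frechet_derivative \<phi> (at (x + ?v))) (at x)"
      by (rule has_derivative_compose[of "\<lambda>y. y + ?v" "\<lambda>h. h" x UNIV \<phi>, OF _ d]) (auto intro!: derivative_eq_intros)
    then have "frechet_derivative \<phi> (at (x + ?v)) = frechet_derivative \<phi> (at x)"
      unfolding per by (rule frechet_derivative_at)
    then show ?thesis by (simp add: pderiv_at_def)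
  qed
  then show ?thesis using Periodic C by auto
next
  case (Homogeneous \<Omega>)
  let ?S = "closure {x. \<phi> x \<noteq> 0}"
  have Ck: "\<And>k. Ck k \<phi>" and S: "compact ?S" "?S \<subseteq> \<Omega>"
    using assms Homogeneous by auto
  have C: "Ck k (pderiv_at i \<phi>)" for k using Ck[of "Suc k"] by auto
  have "pderiv_at i \<phi> x = 0" if "x \<notin> ?S" for x
  proof -
    have "(\<phi> has_derivative (\<lambda>h. 0)) (at x)"
      by (rule has_derivative_transform_within_open[where f = "\<lambda>x. 0" and s = "- ?S"])
        (use that closure_subset[of "{x. \<phi> x \<noteq> 0}"] in auto)
    then have "frechet_derivative \<phi> (at x) = (\<lambda>h. 0)"
      using frechet_derivative_at by metis
    then show ?thesis by (simp add: pderiv_at_def)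
  qed
  then have sub: "{x. pderiv_at i \<phi> x \<noteq> 0} \<subseteq> ?S" by auto
  then have "closure {x. pderiv_at i \<phi> x \<noteq> 0} \<subseteq> ?S" by (simp add: closure_minimal)
  moreover have "compact (closure {x. pderiv_at i \<phi> x \<noteq> 0})"
    using S sub by (metis closed_closure closure_minimal compact_Int_closed inf.absorb_iff2)
  ultimately show ?thesis using S C Homogeneous by auto
qed

text \<open>For products the mixed partial derivatives commute for a trivial reason, so restricting to
  them makes the symmetry of second derivatives unnecessary.\<close>

definition tensor_test :: "flow_domain \<Rightarrow> (real^2 \<Rightarrow> real) \<Rightarrow> bool" where
  "tensor_test D \<phi> \<longleftrightarrow> \<phi> \<in> test_functions D \<and>
     (\<exists>f g. (\<forall>k. C_real k f) \<and> (\<forall>k. C_real k g) \<and> \<phi> = (\<lambda>x. f (x $ 1) * g (x $ 2)))"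

lemma tensor_test_mixed_pderiv:
  assumes "tensor_test D \<phi>"
  shows "pderiv_at 1 (pderiv_at 2 \<phi>) = pderiv_at 2 (pderiv_at 1 \<phi>)"
proof -
  obtain f g where fg: "\<And>k. C_real k f" "\<And>k. C_real k g" and \<phi>: "\<phi> = (\<lambda>x. f (x $ 1) * g (x $ 2))"
    using assms by (auto simp: tensor_test_def)
  note f = C_real_SucD[OF fg(1)] and g = C_real_SucD[OF fg(2)]
  note f' = C_real_SucD[OF f(2)] and g' = C_real_SucD[OF g(2)]
  show ?thesis unfolding \<phi>
    by (simp add: tensor_pderiv_at[OF f(1) g(1)] tensor_pderiv_at[OF f'(1) g(1)] tensor_pderiv_at[OF f(1) g'(1)])
qed

lemma tensor_test_box:
  assumes "valid_domain D" and cd: "\<And>i. c $ i < d $ i" and sub: "cbox c d \<subseteq> region D"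
  obtains \<phi> where "\<And>n::nat. tensor_test D (\<phi> n)" "\<And>n x. 0 \<le> \<phi> n x \<and> \<phi> n x \<le> 1"
    "\<And>x. x \<in> region D \<Longrightarrow> (\<lambda>n. \<phi> n x) \<longlonglongrightarrow> indicator (box c d) x"
proof -
  \<comment> \<open>One profile per coordinate serves both boundary conditions. \<open>pos\<close>
    speaks only of points of the domain, because a periodic profile is positive in the neighbouring
    cells as well; \<open>hom\<close> confines it on the whole line, which yields compact
    support.\<close>
  obtain r :: "2 \<Rightarrow> real \<Rightarrow> real" where r: "\<And>i k. C_real k (r i)"
    and pos: "\<And>i x. x \<in> region D \<Longrightarrow> r i (x $ i) > 0 \<longleftrightarrow> c $ i < x $ i \<and> x $ i < d $ i"
    and per: "\<And>a b i x. D = Periodic a b \<Longrightarrow> r i (x + (b $ i - a $ i)) = r i x"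
    and hom: "\<And>\<Omega> i x. D = Homogeneous \<Omega> \<Longrightarrow> r i x > 0 \<Longrightarrow> c $ i < x \<and> x < d $ i"
  proof (cases D)
    case (Homogeneous \<Omega>)
    define r :: "2 \<Rightarrow> real \<Rightarrow> real" where "r = (\<lambda>i x. (x - c $ i) * (d $ i - x))"
    have p: "r i x > 0 \<longleftrightarrow> c $ i < x \<and> x < d $ i" for i x
      using cd[of i] by (auto simp: r_def zero_less_mult_iff)
    show ?thesis
      by (rule that[of r])
        (use p Homogeneous in \<open>auto simp: r_def intro!: C_real_mult C_real_diff C_real_const C_real_id\<close>)
  next
    case (Periodic a b)
    define L where "L = (\<lambda>i. b $ i - a $ i)"
    \<comment> \<open>Each factor is antiperiodic with antiperiod \<open>L i\<close>, so the product is periodic; in the cell the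
      factors are never both negative, so it is positive there exactly between \<open>c\<close> and \<open>d\<close>.\<close>
    define r :: "2 \<Rightarrow> real \<Rightarrow> real" where
      "r = (\<lambda>i x. sin (pi / L i * (x - c $ i)) * sin (pi / L i * (d $ i - x)))"
    have L: "L i > 0" for i using assms(1) Periodic by (simp add: L_def)
    have "c \<in> box a b" "d \<in> box a b"
      using sub Periodic cd by (auto simp: mem_box_cart less_imp_le subset_iff)
    then have cb: "a $ i < c $ i" "c $ i < b $ i" "a $ i < d $ i" "d $ i < b $ i" for i
      by (auto simp: mem_box_cart)
    have sgn: "sin (pi / L i * y) > 0 \<longleftrightarrow> y > 0" "sin (pi / L i * y) < 0 \<longleftrightarrow> y < 0" if "\<bar>y\<bar> < L i" for i y
    proof -
      have pos: "sin (pi / L i * z) > 0" if "0 < z" "z < L i" for z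
        using that L[of i] by (intro sin_gt_zero) (auto simp: field_simps)
      show "sin (pi / L i * y) > 0 \<longleftrightarrow> y > 0" "sin (pi / L i * y) < 0 \<longleftrightarrow> y < 0"
        using pos[of y] pos[of "-y"] that by (cases y "0::real" rule: linorder_cases; auto)+
    qed
    have p: "r i (x $ i) > 0 \<longleftrightarrow> c $ i < x $ i \<and> x $ i < d $ i" if "x \<in> region D" for i x
    proof -
      have x: "a $ i < x $ i" "x $ i < b $ i" using that Periodic by (auto simp: mem_box_cart)
      have "\<bar>x $ i - c $ i\<bar> < L i" "\<bar>d $ i - x $ i\<bar> < L i"
        using x cb[of i] by (auto simp: L_def)
      then show ?thesis
        using cd[of i] unfolding r_def zero_less_mult_iff
        by (auto simp: sgn simp del: times_divide_eq_left)
    qed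
    have q: "r i (x + L i) = r i x" for i x
    proof -
      have e: "pi / L i * (x + L i - c $ i) = pi / L i * (x - c $ i) + pi"
        "pi / L i * (d $ i - (x + L i)) = pi / L i * (d $ i - x) - pi"
        using L[of i] by (auto simp: field_simps)
      show ?thesis unfolding r_def e by simp
    qed
    have s: "C_real k (r i)" for k i
    proof -
      have "C_real k (\<lambda>x. sin (pi / L i * (x - c $ i)))" "C_real k (\<lambda>x. sin (pi / L i * (d $ i - x)))"
        by (rule C_real_compose[OF C_real_sin_cos[THEN conjunct1]],
            rule C_real_mult[OF C_real_const C_real_diff[OF C_real_id C_real_const]],
            rule C_real_compose[OF C_real_sin_cos[THEN conjunct1]],
            rule C_real_mult[OF C_real_const C_real_diff[OF C_real_const C_real_id]])
      then show ?thesis unfolding r_def by (rule C_real_mult)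
    qed
    show ?thesis
      by (rule that[of r]) (use p q s Periodic in \<open>auto simp: L_def\<close>)
  qed
  define \<psi> where "\<psi> = (\<lambda>n i x. flat_fn 0 (real (Suc n) * r i x))"
  define \<phi> where "\<phi> = (\<lambda>n (x::real^2). \<psi> n 1 (x $ 1) * \<psi> n 2 (x $ 2))"
  have C: "C_real k (\<psi> n i)" for k n i
    unfolding \<psi>_def
    by (intro C_real_compose[OF C_real_flat_fn] C_real_mult C_real_const r)
  have "\<phi> n \<in> test_functions D" for n
  proof -
    have Ck: "Ck k (\<phi> n)" for k unfolding \<phi>_def by (intro Ck_tensor C)
    show ?thesis
    proof (cases D)
      case (Periodic a b)
      have "\<psi> n i (x + (b $ i - a $ i)) = \<psi> n i x" for i x
        using per[OF Periodic] by (simp add: \<psi>_def)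
      then have "\<phi> n (x + axis i (b $ i - a $ i)) = \<phi> n x" for i x
        using exhaust_2[of i] by (auto simp: \<phi>_def axis_def)
      then show ?thesis using Periodic Ck by auto
    next
      case (Homogeneous \<Omega>)
      have "\<psi> n i x \<noteq> 0 \<Longrightarrow> r i x > 0" for i x
        by (auto simp: \<psi>_def flat_fn_def mult_le_0_iff split: if_splits)
      then have "{x. \<phi> n x \<noteq> 0} \<subseteq> cbox c d"
        using hom[OF Homogeneous] by (fastforce simp: \<phi>_def mem_box_cart forall_2)
      then have "closure {x. \<phi> n x \<noteq> 0} \<subseteq> cbox c d"
        by (rule closure_minimal) (rule closed_cbox)
      moreover from this have "compact (closure {x. \<phi> n x \<noteq> 0})"
        using bounded_subset[OF bounded_cbox] by (simp add: compact_eq_bounded_closed)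
      moreover have "cbox c d \<subseteq> \<Omega>" using sub Homogeneous by simp
      ultimately show ?thesis unfolding Homogeneous test_functions.simps using Ck by blast
    qed
  qed
  then have t: "tensor_test D (\<phi> n)" for n
    unfolding tensor_test_def using C
    by (intro conjI exI[of _ "\<psi> n 1"] exI[of _ "\<psi> n 2"]) (simp_all add: \<phi>_def)
  have b: "0 \<le> \<phi> n x \<and> \<phi> n x \<le> 1" for n x
    unfolding \<phi>_def \<psi>_def by (simp add: mult_le_one flat_fn_bounds)
  have l: "(\<lambda>n. \<phi> n x) \<longlonglongrightarrow> indicator (box c d) x" if "x \<in> region D" for x
  proof -
    have "(\<lambda>n. \<phi> n x) \<longlonglongrightarrow> (if r 1 (x $ 1) > 0 then 1 else 0) * (if r 2 (x $ 2) > 0 then 1 else 0)"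
      unfolding \<phi>_def \<psi>_def by (intro tendsto_mult flat_fn_scaled_tendsto)
    then show ?thesis
      using pos[OF that] by (auto simp: indicator_def mem_box_cart forall_2 split: if_splits)
  qed
  show ?thesis by (rule that[OF t b l])
qed

section \<open>Functions with vanishing integrals over boxes\<close>

text \<open>A Dynkin argument: open boxes form an intersection-stable generator of the Borel sets,
  and the sets over which \<open>f\<close> integrates to 0 are closed under complements and
  countable disjoint unions. Once all Borel sets are reached, \<open>f\<close> and 0 agree as
  densities.\<close>

lemma AE_zero_if_box_integrals_zero_lborel:
  fixes f :: "'a::euclidean_space \<Rightarrow> real"
  assumes f: "integrable lborel f" and box: "\<And>c d. (LINT x:box c d|lborel. f x) = 0"
  shows "AE x in lborel. f x = 0"
proof -
  let ?G = "range (\<lambda>(a, b). box a b :: 'a set)"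
  have int: "set_integrable lborel A f" if "A \<in> sets borel" for A
    unfolding set_integrable_def using that f by (intro integrable_mult_indicator) auto
  have sets: "sigma_sets UNIV ?G = sets borel"
    unfolding borel_eq_box by simp
  let ?B = "\<lambda>n::nat. box (- (real n *\<^sub>R One)) (real n *\<^sub>R One) :: 'a set"
  \<comment> \<open>Closure under complements needs the integral over the whole space, obtained as a
    limit over growing cubes.\<close>
  have "(\<lambda>n. LINT x:?B n|lborel. f x) \<longlonglongrightarrow> (LINT x:(\<Union>n. ?B n)|lborel. f x)"
  proof (rule set_integral_cont_up)
    show "incseq ?B"
    proof (rule monoI)
      fix m n :: nat assume "m \<le> n"
      then show "?B m \<subseteq> ?B n" by (intro subset_box_imp) auto
    qed
  qed (use int in \<open>auto simp: UN_box_eq_UNIV\<close>)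
  then have univ: "(LINT x:UNIV|lborel. f x) = 0"
    using LIMSEQ_unique[OF _ tendsto_const] by (simp add: box UN_box_eq_UNIV)
  have "(LINT x:A|lborel. f x) = 0" if "A \<in> sets borel" for A
  proof -
    have "Int_stable ?G" by (auto simp: Int_stable_def box_Int_box)
    moreover have "?G \<subseteq> Pow UNIV" by simp
    moreover have "A \<in> sigma_sets UNIV ?G" using that sets by simp
    ultimately show ?thesis
    proof (induction rule: sigma_sets_induct_disjoint)
      case (basic A)
      then show ?case using box by auto
    next
      case (compl A)
      then have A: "A \<in> sets borel" using sets by simp
      have "(LINT x:A \<union> (UNIV - A)|lborel. f x) = (LINT x:A|lborel. f x) + (LINT x:UNIV - A|lborel. f x)"
        using A by (intro set_integral_Un int) auto
      then show ?case using compl univ by simp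
    next
      case (union A)
      then have A: "\<And>i. A i \<in> sets borel" using sets by auto
      have "(LINT x:(\<Union>i. A i)|lborel. f x) = (\<Sum>i. LINT x:A i|lborel. f x)"
        using A union(1) by (intro lebesgue_integral_countable_add int) (auto simp: disjoint_family_on_def)
      then show ?case using union by simp
    qed (auto simp: set_lebesgue_integral_def)
  qed
  then show ?thesis
    using density_unique_real[OF f, of "\<lambda>_. 0"] by simp
qed

text \<open>Lebesgue measure is the completion of \<open>lborel\<close>, so a Borel representative
  has the same box integrals and the Borel case applies to it.\<close>

lemma AE_zero_if_box_integrals_zero:
  fixes f :: "'a::euclidean_space \<Rightarrow> real"
  assumes f: "integrable lebesgue f" and box: "\<And>c d. (LINT x:box c d|lebesgue. f x) = 0"
  shows "AE x in lebesgue. f x = 0"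
proof -
  obtain f' where f': "f' \<in> borel_measurable lborel" and ae: "AE x in lborel. f x = f' x"
    using completion_ex_borel_measurable_real[OF borel_measurable_integrable[OF f]] by auto
  have ae': "AE x in lebesgue. f x = f' x" using ae by (rule AE_completion)
  have m: "f' \<in> borel_measurable lebesgue" using f' by (simp add: measurable_completion)
  have "integrable lebesgue f'"
    using integrable_cong_AE[OF borel_measurable_integrable[OF f] m ae'] f by simp
  then have "integrable lborel f'" using f' by (simp add: integrable_completion)
  moreover have "(LINT x:box c d|lborel. f' x) = 0" for c d
  proof -
    have "(LINT x:box c d|lborel. f' x) = (LINT x:box c d|lebesgue. f' x)"
      unfolding set_lebesgue_integral_def using f' by (intro integral_completion[symmetric]) simp
    also have "\<dots> = (LINT x:box c d|lebesgue. f x)"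
      unfolding set_lebesgue_integral_def
      by (intro integral_cong_AE borel_measurable_scaleR borel_measurable_indicator m borel_measurable_integrable[OF f])
        (use ae' in auto)
    finally show ?thesis using box by simp
  qed
  ultimately have "AE x in lborel. f' x = 0" by (rule AE_zero_if_box_integrals_zero_lborel)
  then have "AE x in lborel. f x = 0" using ae by eventually_elim simp
  then show ?thesis by (rule AE_completion)
qed

text \<open>The hypothesis is confined to boxes whose closure lies in \<Omega>, as these are the
  ones whose indicators are limits of test functions. Cutting \<open>g\<close> off to one such box
  reduces to the global statement, because boxes intersect in boxes; countably many closed boxes
  then cover \<Omega>.\<close>

lemma AE_zero_if_interior_box_integrals_zero:
  fixes g :: "'a::euclidean_space \<Rightarrow> real"
  assumes "open \<Omega>" and g: "integrable (lebesgue_on \<Omega>) g"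
    and box: "\<And>c d. cbox c d \<subseteq> \<Omega> \<Longrightarrow> box c d \<noteq> {} \<Longrightarrow> (LINT x|lebesgue_on \<Omega>. indicator (box c d) x * g x) = 0"
  shows "AE x in lebesgue_on \<Omega>. g x = 0"
proof -
  have \<Omega>: "\<Omega> \<inter> space lebesgue \<in> sets lebesgue" using \<open>open \<Omega>\<close> by simp
  define G where "G = (\<lambda>x. indicator \<Omega> x * g x)"
  have G: "integrable lebesgue G"
    using g integrable_restrict_space[OF \<Omega>, of g] by (simp add: G_def)
  have boxG: "(LINT x:box c d|lebesgue. G x) = 0" if "cbox c d \<subseteq> \<Omega>" "box c d \<noteq> {}" for c d
    using box[OF that] integral_restrict_space[OF \<Omega>, of "\<lambda>x. indicator (box c d) x * g x"]
    by (simp add: G_def set_lebesgue_integral_def mult.left_commute)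
  have ae: "AE x in lebesgue. x \<in> cbox k l \<longrightarrow> G x = 0" if kl: "cbox k l \<subseteq> \<Omega>" for k l
  proof -
    let ?F = "\<lambda>x. indicator (box k l) x * G x"
    have "AE x in lebesgue. ?F x = 0"
    proof (rule AE_zero_if_box_integrals_zero)
      show "integrable lebesgue ?F"
        using integrable_mult_indicator[OF _ G, of "box k l"] by simp
      fix c d :: 'a
      obtain e f where ef: "box c d \<inter> box k l = box e f" unfolding box_Int_box by blast
      have "(LINT x:box c d|lebesgue. ?F x) = (LINT x:box e f|lebesgue. G x)"
        unfolding set_lebesgue_integral_def ef[symmetric] by (simp add: indicator_inter_arith mult.assoc)
      also have "\<dots> = 0"
      proof (cases "box e f = {}")
        case False
        \<comment> \<open>The hypothesis asks for the closed box inside \<Omega>. Inclusion of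
          nonempty open boxes passes to the closed ones by taking closures.\<close>
        have "closure (box e f) \<subseteq> closure (box k l)" by (rule closure_mono) (use ef in auto)
        moreover have "box k l \<noteq> {}" using False ef by auto
        ultimately have "cbox e f \<subseteq> cbox k l" using False by (simp add: closure_box)
        then show ?thesis using boxG False kl by blast
      qed (simp add: set_lebesgue_integral_def)
      finally show "(LINT x:box c d|lebesgue. ?F x) = 0" .
    qed
    \<comment> \<open>The cut-off function controls the open box only; its faces form a null
      set.\<close>
    moreover have "AE x in lebesgue. x \<notin> cbox k l - box k l"
      using negligible_frontier_interval[of k l] by (intro AE_not_in) (simp add: negligible_iff_null_sets)
    ultimately show ?thesis by eventually_elim auto
  qed
  obtain \<D> where \<D>: "countable \<D>" "\<D> \<subseteq> Pow \<Omega>" "\<And>X. X \<in> \<D> \<Longrightarrow> \<exists>a b. X = cbox a b" "\<Union>\<D> = \<Omega>"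
    using open_countable_Union_open_cbox[OF \<open>open \<Omega>\<close>] by metis
  have "AE x in lebesgue. x \<in> X \<longrightarrow> G x = 0" if "X \<in> \<D>" for X
    using \<D>(2,3) that ae by blast
  then have "AE x in lebesgue. \<forall>X\<in>\<D>. x \<in> X \<longrightarrow> G x = 0"
    unfolding AE_ball_countable[OF \<D>(1)] by blast
  then have "AE x in lebesgue. x \<in> \<Omega> \<longrightarrow> g x = 0"
    by eventually_elim (use \<D>(4) in \<open>force simp: G_def indicator_def\<close>)
  then show ?thesis using \<Omega> by (simp add: AE_restrict_space_iff)
qed

section \<open>Finite-dimensional subspaces of the square integrable functions\<close>

lemma L2_D:
  assumes "f \<in> L2 \<Omega>"
  shows "f \<in> borel_measurable (lebesgue_on \<Omega>)" "integrable (lebesgue_on \<Omega>) (\<lambda>x. (norm (f x))\<^sup>2)"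
  using assms by (auto simp: L2_def)

lemma L2_inner_integrable:
  assumes "f \<in> L2 \<Omega>" "g \<in> L2 \<Omega>"
  shows "integrable (lebesgue_on \<Omega>) (\<lambda>x. f x \<bullet> g x)"
proof (rule Bochner_Integration.integrable_bound)
  note [measurable] = L2_D(1)[OF assms(1)] L2_D(1)[OF assms(2)]
  show "integrable (lebesgue_on \<Omega>) (\<lambda>x. (norm (f x))\<^sup>2 + (norm (g x))\<^sup>2)"
    using L2_D(2)[OF assms(1)] L2_D(2)[OF assms(2)] by (rule Bochner_Integration.integrable_add)
  show "(\<lambda>x. f x \<bullet> g x) \<in> borel_measurable (lebesgue_on \<Omega>)" by measurable
  have "\<bar>f x \<bullet> g x\<bar> \<le> (norm (f x))\<^sup>2 + (norm (g x))\<^sup>2" for x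
  proof -
    have "\<bar>f x \<bullet> g x\<bar> \<le> norm (f x) * norm (g x)" by (rule Cauchy_Schwarz_ineq2)
    also have "\<dots> \<le> (norm (f x))\<^sup>2 + (norm (g x))\<^sup>2"
      using sum_squares_bound[of "norm (f x)" "norm (g x)"]
        mult_nonneg_nonneg[OF norm_ge_zero[of "f x"] norm_ge_zero[of "g x"]] by linarith
    finally show ?thesis .
  qed
  then show "AE x in lebesgue_on \<Omega>. norm (f x \<bullet> g x) \<le> norm ((norm (f x))\<^sup>2 + (norm (g x))\<^sup>2)"
    by simp
qed

text \<open>The two-term form copies the closure condition of \<open>discrete_space\<close>.
  Differences and multiples are treated as instances of it, hence the unsimplified terms such as
  \<open>1 *\<^sub>R f x + (- 1) *\<^sub>R g x\<close> further on.\<close>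

lemma L2_lincomb:
  assumes "f \<in> L2 \<Omega>" "g \<in> L2 \<Omega>"
  shows "(\<lambda>x. \<alpha> *\<^sub>R f x + \<beta> *\<^sub>R g x) \<in> L2 \<Omega>"
proof -
  note [measurable] = L2_D(1)[OF assms(1)] L2_D(1)[OF assms(2)]
  have "(norm (\<alpha> *\<^sub>R f x + \<beta> *\<^sub>R g x))\<^sup>2 = \<alpha>\<^sup>2 * (f x \<bullet> f x) + 2 * \<alpha> * \<beta> * (f x \<bullet> g x) + \<beta>\<^sup>2 * (g x \<bullet> g x)" for x
    unfolding power2_norm_eq_inner inner_add_left inner_add_right
    by (simp add: inner_commute[of "g x" "f x"] power2_eq_square)
  then show ?thesis
    using L2_inner_integrable[OF assms(1,1)] L2_inner_integrable[OF assms(1,2)] L2_inner_integrable[OF assms(2,2)]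
    unfolding L2_def by simp
qed

lemma l2_inner_lincomb:
  assumes "f \<in> L2 \<Omega>" "g \<in> L2 \<Omega>" "h \<in> L2 \<Omega>"
  shows "l2_inner \<Omega> (\<lambda>x. \<alpha> *\<^sub>R f x + \<beta> *\<^sub>R g x) h = \<alpha> * l2_inner \<Omega> f h + \<beta> * l2_inner \<Omega> g h"
  using L2_inner_integrable[OF assms(1,3)] L2_inner_integrable[OF assms(2,3)]
  by (simp add: l2_inner_def inner_add_left)

lemma l2_inner_commute: "l2_inner \<Omega> f g = l2_inner \<Omega> g f"
  by (simp add: l2_inner_def inner_commute)

lemma l2_inner_lincomb_right:
  assumes "f \<in> L2 \<Omega>" "g \<in> L2 \<Omega>" "h \<in> L2 \<Omega>"
  shows "l2_inner \<Omega> h (\<lambda>x. \<alpha> *\<^sub>R f x + \<beta> *\<^sub>R g x) = \<alpha> * l2_inner \<Omega> h f + \<beta> * l2_inner \<Omega> h g"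
  using l2_inner_lincomb[OF assms] by (simp add: l2_inner_commute)

lemma l2_inner_cong:
  assumes "f \<in> L2 \<Omega>" "f' \<in> L2 \<Omega>" "g \<in> L2 \<Omega>" "g' \<in> L2 \<Omega>" "ae_eq \<Omega> f f'" "ae_eq \<Omega> g g'"
  shows "l2_inner \<Omega> f g = l2_inner \<Omega> f' g'"
  unfolding l2_inner_def
proof (rule integral_cong_AE)
  show "AE x in lebesgue_on \<Omega>. f x \<bullet> g x = f' x \<bullet> g' x"
    using assms(5,6) unfolding ae_eq_def by eventually_elim simp
qed (intro borel_measurable_inner L2_D(1) assms)+

text \<open>The other factor \<open>g\<close> is arbitrary: an integrand that vanishes almost
  everywhere has integral 0. This allows pairing with functions not known to be square
  integrable.\<close>

lemma l2_inner_ae_zero: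
  assumes "ae_eq \<Omega> f (\<lambda>x. 0)"
  shows "l2_inner \<Omega> f g = 0" "l2_inner \<Omega> g f = 0"
proof -
  have "AE x in lebesgue_on \<Omega>. f x \<bullet> g x = 0" "AE x in lebesgue_on \<Omega>. g x \<bullet> f x = 0"
    using assms unfolding ae_eq_def by (eventually_elim, simp)+
  then show "l2_inner \<Omega> f g = 0" "l2_inner \<Omega> g f = 0"
    unfolding l2_inner_def by (simp_all only: integral_eq_zero_AE)
qed

lemma l2_inner_self_nonneg: "0 \<le> l2_inner \<Omega> f f"
  unfolding l2_inner_def by (intro integral_nonneg_AE) simp

lemma l2_inner_self_eq_0:
  assumes "f \<in> L2 \<Omega>" "l2_inner \<Omega> f f = 0"
  shows "ae_eq \<Omega> f (\<lambda>x. 0)"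
proof -
  have "AE x in lebesgue_on \<Omega>. f x \<bullet> f x = 0"
    using integral_nonneg_eq_0_iff_AE[OF L2_inner_integrable[OF assms(1,1)]] assms(2)
    by (simp add: l2_inner_def)
  then show ?thesis by (simp add: ae_eq_def)
qed

lemma l2_Cauchy_Schwarz:
  assumes f: "f \<in> L2 \<Omega>" and g: "g \<in> L2 \<Omega>"
  shows "(l2_inner \<Omega> f g)\<^sup>2 \<le> l2_inner \<Omega> f f * l2_inner \<Omega> g g"
proof (cases "l2_inner \<Omega> g g = 0")
  case True
  then show ?thesis
    using l2_inner_ae_zero[OF l2_inner_self_eq_0[OF g True], of f] by simp
next
  case False
  then have pos: "l2_inner \<Omega> g g > 0" using l2_inner_self_nonneg[of \<Omega> g] by linarith
  \<comment> \<open>This value minimises the squared norm of \<open>f + t g\<close> as a quadratic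
    in \<open>t\<close>; its nonnegativity at the minimum is the inequality.\<close>
  let ?t = "- (l2_inner \<Omega> f g / l2_inner \<Omega> g g)"
  let ?h = "\<lambda>x. 1 *\<^sub>R f x + ?t *\<^sub>R g x"
  have h: "?h \<in> L2 \<Omega>" by (rule L2_lincomb[OF f g])
  have "0 \<le> l2_inner \<Omega> ?h ?h" by (rule l2_inner_self_nonneg)
  also have "\<dots> = l2_inner \<Omega> f f + 2 * ?t * l2_inner \<Omega> f g + ?t\<^sup>2 * l2_inner \<Omega> g g"
    unfolding l2_inner_lincomb[OF f g h] l2_inner_lincomb_right[OF f g f] l2_inner_lincomb_right[OF f g g]
    by (simp add: l2_inner_commute[of \<Omega> g f] power2_eq_square algebra_simps)
  also have "\<dots> = l2_inner \<Omega> f f - (l2_inner \<Omega> f g)\<^sup>2 / l2_inner \<Omega> g g"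
    using pos by (simp add: power2_eq_square field_simps)
  finally show ?thesis using pos by (simp add: field_simps)
qed

lemma l2_inner_abs_le:
  assumes "f \<in> L2 \<Omega>" "g \<in> L2 \<Omega>"
  shows "\<bar>l2_inner \<Omega> f g\<bar> \<le> l2_norm \<Omega> f * l2_norm \<Omega> g"
proof -
  have "sqrt ((l2_inner \<Omega> f g)\<^sup>2) \<le> sqrt (l2_inner \<Omega> f f * l2_inner \<Omega> g g)"
    by (rule real_sqrt_le_mono) (rule l2_Cauchy_Schwarz[OF assms])
  then show ?thesis by (simp add: l2_norm_def real_sqrt_mult)
qed

lemma ae_eq_refl: "ae_eq \<Omega> f f"
  by (simp add: ae_eq_def)

lemma ae_eq_trans:
  assumes "ae_eq \<Omega> f g" "ae_eq \<Omega> g h"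
  shows "ae_eq \<Omega> f h"
  using assms unfolding ae_eq_def by eventually_elim simp

lemma ae_eq_lincomb:
  assumes "ae_eq \<Omega> f f'" "ae_eq \<Omega> g g'"
  shows "ae_eq \<Omega> (\<lambda>x. \<alpha> *\<^sub>R f x + \<beta> *\<^sub>R g x) (\<lambda>x. \<alpha> *\<^sub>R f' x + \<beta> *\<^sub>R g' x)"
  using assms unfolding ae_eq_def by eventually_elim simp

section \<open>Spans, orthonormal systems and Riesz representation modulo null sets\<close>

locale l2_subspace =
  fixes \<Omega> :: "(real^2) set" and W :: "(real^2 \<Rightarrow> 'b::euclidean_space) set"
  assumes sub_L2: "W \<subseteq> L2 \<Omega>"
    and zero_mem: "(\<lambda>x. 0) \<in> W"
    and lincomb_mem: "f \<in> W \<Longrightarrow> g \<in> W \<Longrightarrow> (\<lambda>x. \<alpha> *\<^sub>R f x + \<beta> *\<^sub>R g x) \<in> W"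
begin

lemma L2_mem: "f \<in> W \<Longrightarrow> f \<in> L2 \<Omega>"
  using sub_L2 by blast

text \<open>\<open>F\<close> is linear on \<open>W\<close> only, so the induction step for linearity
  needs the partial sum to lie in \<open>W\<close>; both claims go through one induction.\<close>

lemma sum_mem_and_linear:
  assumes F: "\<And>f g \<alpha> \<beta>. f \<in> W \<Longrightarrow> g \<in> W \<Longrightarrow> F (\<lambda>x. \<alpha> *\<^sub>R f x + \<beta> *\<^sub>R g x) = \<alpha> * F f + \<beta> * (F g :: real)"
    and "finite E" "E \<subseteq> W"
  shows "(\<lambda>x. \<Sum>e\<in>E. c e *\<^sub>R e x) \<in> W \<and> F (\<lambda>x. \<Sum>e\<in>E. c e *\<^sub>R e x) = (\<Sum>e\<in>E. c e * F e)"
  using \<open>finite E\<close> \<open>E \<subseteq> W\<close>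
proof (induction E)
  case empty
  show ?case using zero_mem F[OF zero_mem zero_mem, of 0 0] by simp
next
  case (insert e E)
  then have e: "e \<in> W" and s: "(\<lambda>x. \<Sum>e\<in>E. c e *\<^sub>R e x) \<in> W" by auto
  show ?case
    using lincomb_mem[OF e s, of "c e" 1] F[OF e s, of "c e" 1] insert by simp
qed

lemma sum_mem: "finite E \<Longrightarrow> E \<subseteq> W \<Longrightarrow> (\<lambda>x. \<Sum>e\<in>E. c e *\<^sub>R e x) \<in> W"
  using sum_mem_and_linear[of "\<lambda>_. 0" E] by simp

lemma linear_sum:
  assumes "\<And>f g \<alpha> \<beta>. f \<in> W \<Longrightarrow> g \<in> W \<Longrightarrow> F (\<lambda>x. \<alpha> *\<^sub>R f x + \<beta> *\<^sub>R g x) = \<alpha> * F f + \<beta> * (F g :: real)"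
    and "finite E" "E \<subseteq> W"
  shows "F (\<lambda>x. \<Sum>e\<in>E. c e *\<^sub>R e x) = (\<Sum>e\<in>E. c e * F e)"
  by (rule sum_mem_and_linear[of F, OF assms, THEN conjunct2])

lemma l2_inner_sum:
  assumes "finite E" "E \<subseteq> W" "h \<in> L2 \<Omega>"
  shows "l2_inner \<Omega> (\<lambda>x. \<Sum>e\<in>E. c e *\<^sub>R e x) h = (\<Sum>e\<in>E. c e * l2_inner \<Omega> e h)"
  by (rule linear_sum[where F = "\<lambda>f. l2_inner \<Omega> f h", OF _ assms(1,2)])
    (rule l2_inner_lincomb[OF L2_mem L2_mem assms(3)])

definition orthonormal :: "(real^2 \<Rightarrow> 'b) set \<Rightarrow> bool" where
  "orthonormal E \<longleftrightarrow> finite E \<and> E \<subseteq> W \<and>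
     (\<forall>e\<in>E. \<forall>e'\<in>E. l2_inner \<Omega> e e' = (if e = e' then 1 else 0))"

text \<open>Equality is relaxed to equality almost everywhere because \<open>discrete_space\<close>
  promises a finite spanning set only in this sense.\<close>

definition l2_span :: "(real^2 \<Rightarrow> 'b) set \<Rightarrow> (real^2 \<Rightarrow> 'b) set" where
  "l2_span E = {f. \<exists>c. ae_eq \<Omega> f (\<lambda>x. \<Sum>e\<in>E. c e *\<^sub>R e x)}"

lemma l2_span_ae: "f \<in> l2_span E \<Longrightarrow> ae_eq \<Omega> g f \<Longrightarrow> g \<in> l2_span E"
  unfolding l2_span_def using ae_eq_trans by blast

lemma l2_span_zero: "(\<lambda>x. 0) \<in> l2_span E"
  unfolding l2_span_def by (auto intro!: exI[of _ "\<lambda>_. 0"] simp: ae_eq_refl)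

lemma l2_span_lincomb:
  assumes "f \<in> l2_span E" "g \<in> l2_span E"
  shows "(\<lambda>x. \<alpha> *\<^sub>R f x + \<beta> *\<^sub>R g x) \<in> l2_span E"
proof -
  obtain c d where "ae_eq \<Omega> f (\<lambda>x. \<Sum>e\<in>E. c e *\<^sub>R e x)" "ae_eq \<Omega> g (\<lambda>x. \<Sum>e\<in>E. d e *\<^sub>R e x)"
    using assms by (auto simp: l2_span_def)
  from ae_eq_lincomb[OF this, of \<alpha> \<beta>]
  have "ae_eq \<Omega> (\<lambda>x. \<alpha> *\<^sub>R f x + \<beta> *\<^sub>R g x) (\<lambda>x. \<Sum>e\<in>E. (\<alpha> * c e + \<beta> * d e) *\<^sub>R e x)"
    by (simp only: scaleR_sum_right scaleR_scaleR scaleR_add_left sum.distrib)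
  then show ?thesis
    unfolding l2_span_def mem_Collect_eq by (intro exI[of _ "\<lambda>e. \<alpha> * c e + \<beta> * d e"])
qed

lemma l2_span_sum:
  assumes "finite B" "B \<subseteq> l2_span E"
  shows "(\<lambda>x. \<Sum>b\<in>B. c b *\<^sub>R b x) \<in> l2_span E"
  using assms
proof (induction B)
  case empty
  show ?case using l2_span_zero by simp
next
  case (insert b B)
  then show ?case
    using l2_span_lincomb[of b E "\<lambda>x. \<Sum>b\<in>B. c b *\<^sub>R b x" "c b" 1] by simp
qed

lemma l2_span_trans:
  assumes "finite B" "B \<subseteq> l2_span E" "f \<in> l2_span B"
  shows "f \<in> l2_span E"
proof -
  obtain c where "ae_eq \<Omega> f (\<lambda>x. \<Sum>b\<in>B. c b *\<^sub>R b x)" using assms(3) by (auto simp: l2_span_def)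
  then show ?thesis by (rule l2_span_ae[OF l2_span_sum[OF assms(1,2)]])
qed

lemma l2_span_superset:
  assumes "finite E"
  shows "E \<subseteq> l2_span E"
proof
  fix e assume e: "e \<in> E"
  have "(\<Sum>e'\<in>E. (if e' = e then 1 else 0) *\<^sub>R e' x) = e x" for x
    using assms e by (simp add: if_distrib[of "\<lambda>a. a *\<^sub>R _"] sum.delta cong: if_cong)
  then show "e \<in> l2_span E"
    unfolding l2_span_def by (auto intro!: exI[of _ "\<lambda>e'. if e' = e then 1 else 0"] simp: ae_eq_refl)
qed

lemma Gram_Schmidt:
  assumes "finite B" "B \<subseteq> W"
  shows "\<exists>E. orthonormal E \<and> B \<subseteq> l2_span E"
  using assms
proof (induction B)
  case empty
  show ?case by (auto intro!: exI[of _ "{}"] simp: orthonormal_def)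
next
  case (insert b B)
  then obtain E where E: "orthonormal E" "B \<subseteq> l2_span E" by auto
  have fin: "finite E" and EW: "E \<subseteq> W"
    and on: "\<And>e e'. e \<in> E \<Longrightarrow> e' \<in> E \<Longrightarrow> l2_inner \<Omega> e e' = (if e = e' then 1 else 0)"
    using E(1) by (auto simp: orthonormal_def)
  have b: "b \<in> W" using insert by simp
  define p where "p = (\<lambda>x. \<Sum>e\<in>E. l2_inner \<Omega> b e *\<^sub>R e x)"
  define r where "r = (\<lambda>x. 1 *\<^sub>R b x + (- 1) *\<^sub>R p x)"
  have p: "p \<in> W" unfolding p_def by (rule sum_mem[OF fin EW])
  have r: "r \<in> W" unfolding r_def by (rule lincomb_mem[OF b p])
  have p_span: "p \<in> l2_span E" unfolding p_def l2_span_def using ae_eq_refl by blast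
  have re: "l2_inner \<Omega> r e = 0" if "e \<in> E" for e
  proof -
    have e: "e \<in> L2 \<Omega>" using that EW sub_L2 by auto
    have "l2_inner \<Omega> p e = (\<Sum>e'\<in>E. if e' = e then l2_inner \<Omega> b e else 0)"
      unfolding p_def l2_inner_sum[OF fin EW e] by (rule sum.cong) (auto simp: on that)
    then show ?thesis
      unfolding r_def l2_inner_lincomb[OF L2_mem[OF b] L2_mem[OF p] e] using fin that by simp
  qed
  show ?case
  \<comment> \<open>A null remainder means that \<open>b\<close> already lies in the span of
    \<open>E\<close> modulo null sets; otherwise the remainder is normalised and added.\<close>
  proof (cases "l2_inner \<Omega> r r = 0")
    case True
    then have "ae_eq \<Omega> r (\<lambda>x. 0)" by (rule l2_inner_self_eq_0[OF L2_mem[OF r]])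
    then have "ae_eq \<Omega> b p" unfolding ae_eq_def r_def by eventually_elim simp
    then have "b \<in> l2_span E" using p_span l2_span_ae by blast
    then show ?thesis using E by auto
  next
    case False
    then have pos: "l2_inner \<Omega> r r > 0" using l2_inner_self_nonneg[of \<Omega> r] by linarith
    define s where "s = l2_norm \<Omega> r"
    have s: "s > 0" "s\<^sup>2 = l2_inner \<Omega> r r" using pos by (simp_all add: s_def l2_norm_def)
    \<comment> \<open>The summand with coefficient 0 only pads the multiple of \<open>r\<close> to
      the two-term form of \<open>lincomb_mem\<close>.\<close>
    define e0 where "e0 = (\<lambda>x. (1 / s) *\<^sub>R r x + 0 *\<^sub>R r x)"
    have e0: "e0 \<in> W" unfolding e0_def by (rule lincomb_mem[OF r r])
    have e0e: "l2_inner \<Omega> e0 e = 0" if "e \<in> E" for e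
      unfolding e0_def using l2_inner_lincomb[OF L2_mem[OF r] L2_mem[OF r], of e "1 / s" 0] re[OF that] that EW sub_L2
      by auto
    have "l2_inner \<Omega> e0 e0 = 1 / s * (1 / s * l2_inner \<Omega> r r)"
      unfolding l2_inner_lincomb[OF L2_mem[OF r] L2_mem[OF r] L2_mem[OF e0], of "1/s" 0, folded e0_def]
        l2_inner_lincomb_right[OF L2_mem[OF r] L2_mem[OF r] L2_mem[OF r], of "1/s" 0, folded e0_def] by simp
    then have e0e0: "l2_inner \<Omega> e0 e0 = 1" using s by (simp add: s(2)[symmetric] power2_eq_square)
    have "orthonormal (insert e0 E)"
    proof -
      have "l2_inner \<Omega> e e0 = 0" if "e \<in> E" for e
        using e0e[OF that] by (subst l2_inner_commute)
      moreover have "e0 \<notin> E" using e0e e0e0 by auto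
      ultimately show ?thesis
        unfolding orthonormal_def using fin EW e0 on e0e e0e0 by auto
    qed
    moreover have E': "E \<subseteq> l2_span (insert e0 E)" "e0 \<in> l2_span (insert e0 E)"
      using l2_span_superset[of "insert e0 E"] fin by auto
    then have "p \<in> l2_span (insert e0 E)" "B \<subseteq> l2_span (insert e0 E)"
      using l2_span_trans[OF fin] p_span E(2) by blast+
    moreover have "b \<in> l2_span (insert e0 E)"
    proof -
      have "b = (\<lambda>x. 1 *\<^sub>R p x + s *\<^sub>R e0 x)" using s by (simp add: fun_eq_iff e0_def r_def)
      then show ?thesis using l2_span_lincomb[of p "insert e0 E" e0 1 s] calculation E' by simp
    qed
    ultimately show ?thesis by auto
  qed
qed

lemma orthonormal_expansion:
  assumes "orthonormal E" "f \<in> l2_span E" "f \<in> W"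
  shows "ae_eq \<Omega> f (\<lambda>x. \<Sum>e\<in>E. l2_inner \<Omega> f e *\<^sub>R e x)"
proof -
  have fin: "finite E" and EW: "E \<subseteq> W"
    and on: "\<And>e e'. e \<in> E \<Longrightarrow> e' \<in> E \<Longrightarrow> l2_inner \<Omega> e e' = (if e = e' then 1 else 0)"
    using assms(1) by (auto simp: orthonormal_def)
  obtain c where c: "ae_eq \<Omega> f (\<lambda>x. \<Sum>e\<in>E. c e *\<^sub>R e x)" using assms(2) by (auto simp: l2_span_def)
  have "l2_inner \<Omega> f e = c e" if "e \<in> E" for e
  proof -
    have e: "e \<in> L2 \<Omega>" using that EW sub_L2 by auto
    have "l2_inner \<Omega> f e = l2_inner \<Omega> (\<lambda>x. \<Sum>e\<in>E. c e *\<^sub>R e x) e"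
      by (rule l2_inner_cong[OF L2_mem[OF assms(3)] L2_mem[OF sum_mem[OF fin EW]] e e c ae_eq_refl])
    also have "\<dots> = (\<Sum>e'\<in>E. if e' = e then c e else 0)"
      unfolding l2_inner_sum[OF fin EW e] by (rule sum.cong) (auto simp: on that)
    finally show ?thesis using fin that by simp
  qed
  then show ?thesis using c by simp
qed

text \<open>The representer is the sum of \<open>F e *\<^sub>R e\<close>. Invariance of
  \<open>F\<close> under equality almost everywhere is required since the basis expansion of
  \<open>v\<close> holds only in that sense.\<close>

lemma Riesz:
  assumes E: "orthonormal E" "W \<subseteq> l2_span E"
    and F: "\<And>f g \<alpha> \<beta>. f \<in> W \<Longrightarrow> g \<in> W \<Longrightarrow> F (\<lambda>x. \<alpha> *\<^sub>R f x + \<beta> *\<^sub>R g x) = \<alpha> * F f + \<beta> * (F g :: real)"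
    and F_ae: "\<And>f g. f \<in> W \<Longrightarrow> g \<in> W \<Longrightarrow> ae_eq \<Omega> f g \<Longrightarrow> F f = F g"
  shows "\<exists>g\<in>W. \<forall>v\<in>W. l2_inner \<Omega> g v = F v"
proof (intro bexI ballI)
  have fin: "finite E" and EW: "E \<subseteq> W" using E(1) by (auto simp: orthonormal_def)
  show "(\<lambda>x. \<Sum>e\<in>E. F e *\<^sub>R e x) \<in> W" by (rule sum_mem[OF fin EW])
  fix v assume v: "v \<in> W"
  have "F v = F (\<lambda>x. \<Sum>e\<in>E. l2_inner \<Omega> v e *\<^sub>R e x)"
    using E v by (intro F_ae orthonormal_expansion sum_mem fin EW) auto
  also have "\<dots> = (\<Sum>e\<in>E. l2_inner \<Omega> v e * F e)"
    by (rule linear_sum[of F, OF F fin EW])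
  also have "\<dots> = l2_inner \<Omega> (\<lambda>x. \<Sum>e\<in>E. F e *\<^sub>R e x) v"
    unfolding l2_inner_sum[OF fin EW L2_mem[OF v]] by (simp add: l2_inner_commute mult.commute)
  finally show "l2_inner \<Omega> (\<lambda>x. \<Sum>e\<in>E. F e *\<^sub>R e x) v = F v" by simp
qed

lemma Parseval:
  assumes E: "orthonormal E" "W \<subseteq> l2_span E" and w: "w \<in> W"
  shows "l2_inner \<Omega> w w = (\<Sum>e\<in>E. (l2_inner \<Omega> w e)\<^sup>2)"
proof -
  have fin: "finite E" and EW: "E \<subseteq> W" using E(1) by (auto simp: orthonormal_def)
  have "l2_inner \<Omega> w w = l2_inner \<Omega> (\<lambda>x. \<Sum>e\<in>E. l2_inner \<Omega> w e *\<^sub>R e x) w"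
    using E w by (intro l2_inner_cong L2_mem orthonormal_expansion sum_mem fin EW ae_eq_refl) auto
  also have "\<dots> = (\<Sum>e\<in>E. l2_inner \<Omega> w e * l2_inner \<Omega> e w)"
    by (rule l2_inner_sum[OF fin EW L2_mem[OF w]])
  also have "\<dots> = (\<Sum>e\<in>E. (l2_inner \<Omega> w e)\<^sup>2)"
    by (rule sum.cong[OF refl]) (subst l2_inner_commute, simp add: power2_eq_square)
  finally show ?thesis .
qed

end

lemma discrete_space_l2_subspace:
  assumes "discrete_space \<Omega> V W" "V \<subseteq> L2 \<Omega>"
  shows "l2_subspace \<Omega> W"
proof
  show "W \<subseteq> L2 \<Omega>" using assms by (auto simp: discrete_space_def)
qed (use assms(1) in \<open>simp_all add: discrete_space_def\<close>)

lemma discrete_space_orthonormal_basis: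
  assumes "discrete_space \<Omega> V W" "V \<subseteq> L2 \<Omega>"
  obtains E where "l2_subspace.orthonormal \<Omega> W E" "W \<subseteq> l2_subspace.l2_span \<Omega> E"
proof -
  interpret l2_subspace \<Omega> W by (rule discrete_space_l2_subspace[OF assms])
  obtain B where B: "finite B" "B \<subseteq> W" "\<And>f. f \<in> W \<Longrightarrow> f \<in> l2_span B"
    using assms(1) unfolding discrete_space_def l2_span_def by blast
  obtain E where "orthonormal E" "B \<subseteq> l2_span E" using Gram_Schmidt[OF B(1,2)] by blast
  then show ?thesis using that l2_span_trans[OF B(1)] B(3) by blast
qed

section \<open>Weak derivatives\<close>

lemma region_open:
  assumes "valid_domain D"
  shows "open (region D)" "bounded (region D)" "region D \<in> sets lebesgue"
proof -
  show "open (region D)" "bounded (region D)" using assms by (cases D; auto)+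
  then show "region D \<in> sets lebesgue" by simp
qed

lemma finite_measure_region:
  assumes "valid_domain D"
  shows "finite_measure (lebesgue_on (region D))"
proof -
  have "region D \<in> lmeasurable"
    using region_open[OF assms] by (intro lmeasurable_open)
  then show ?thesis by (rule finite_measure_lebesgue_on)
qed

lemma continuous_in_L2:
  fixes f :: "real^2 \<Rightarrow> 'b::euclidean_space"
  assumes D: "valid_domain D" and f: "continuous_on UNIV f"
  shows "f \<in> L2 (region D)"
proof -
  note R = region_open[OF D]
  interpret finite_measure "lebesgue_on (region D)" by (rule finite_measure_region[OF D])
  have m: "f \<in> borel_measurable (lebesgue_on (region D))"
    by (rule continuous_imp_measurable_on_sets_lebesgue[OF continuous_on_subset[OF f] R(3)]) simp
  have "compact (f ` closure (region D))"
    using R(2) by (intro compact_continuous_image continuous_on_subset[OF f]) (auto simp: compact_closure)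
  then obtain C where C: "\<And>x. x \<in> region D \<Longrightarrow> norm (f x) \<le> C"
    using compact_imp_bounded[of "f ` closure (region D)"] closure_subset[of "region D"]
    unfolding bounded_iff by blast
  have "AE x in lebesgue_on (region D). norm ((norm (f x))\<^sup>2) \<le> C\<^sup>2"
    by (rule AE_I2) (use C in \<open>auto simp: power_mono\<close>)
  then have "integrable (lebesgue_on (region D)) (\<lambda>x. (norm (f x))\<^sup>2)"
    using m by (intro integrable_const_bound) simp_all
  then show ?thesis using m by (simp add: L2_def)
qed

lemma test_function_Ck: "\<phi> \<in> test_functions D \<Longrightarrow> Ck k \<phi>"
  by (cases D) auto

lemma test_function_continuous: "\<phi> \<in> test_functions D \<Longrightarrow> continuous_on UNIV \<phi>"
  using test_function_Ck[of \<phi> D 0] by simp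

lemma test_function_in_L2:
  assumes "valid_domain D" "\<phi> \<in> test_functions D"
  shows "\<phi> \<in> L2 (region D)"
  using assms by (intro continuous_in_L2 test_function_continuous)

lemma test_function_grad_in_L2:
  assumes "valid_domain D" "\<phi> \<in> test_functions D"
  shows "(\<lambda>x. \<chi> i. pderiv_at i \<phi> x) \<in> L2 (region D)"
  using assms by (intro continuous_in_L2 continuous_on_vec_lambda test_function_continuous pderiv_at_test_function)

text \<open>The fundamental lemma of the calculus of variations, with product test functions;
  dominated convergence turns orthogonality into vanishing box integrals.\<close>

lemma l2_orthogonal_tensor_tests:
  assumes D: "valid_domain D" and g: "g \<in> L2 (region D)"
    and orth: "\<And>\<phi>. tensor_test D \<phi> \<Longrightarrow> l2_inner (region D) g \<phi> = 0"
  shows "ae_eq (region D) g (\<lambda>x. 0)"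
proof -
  let ?M = "lebesgue_on (region D)"
  \<comment> \<open>On a domain of finite measure the constant 1 is square integrable, so
    \<open>g\<close> is integrable; its absolute value is the dominating function below.\<close>
  have "integrable ?M (\<lambda>x. g x \<bullet> 1)"
    by (rule L2_inner_integrable[OF g continuous_in_L2[OF D]]) simp
  then have gi: "integrable ?M g" by simp
  have "AE x in ?M. g x = 0"
  proof (rule AE_zero_if_interior_box_integrals_zero[OF region_open(1)[OF D] gi])
    fix c d :: "real^2" assume sub: "cbox c d \<subseteq> region D" and ne: "box c d \<noteq> {}"
    have cd: "c $ i < d $ i" for i using ne by (auto simp: box_ne_empty inner_axis Basis_vec_def)
    obtain \<phi> where t: "\<And>n::nat. tensor_test D (\<phi> n)" and b: "\<And>n x. 0 \<le> \<phi> n x \<and> \<phi> n x \<le> 1"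
      and l: "\<And>x. x \<in> region D \<Longrightarrow> (\<lambda>n. \<phi> n x) \<longlonglongrightarrow> indicator (box c d) x"
      using tensor_test_box[OF D cd sub] by blast
    have t': "\<phi> n \<in> L2 (region D)" for n
      by (rule test_function_in_L2[OF D]) (use t[of n] in \<open>simp add: tensor_test_def\<close>)
    note [measurable] = L2_D(1)[OF g] L2_D(1)[OF t']
    have "(\<lambda>n. LINT x|?M. g x * \<phi> n x) \<longlonglongrightarrow> (LINT x|?M. g x * indicator (box c d) x)"
    proof (rule integral_dominated_convergence)
      show "(\<lambda>x. g x * indicator (box c d) x) \<in> borel_measurable ?M"
        by (rule borel_measurable_times[OF L2_D(1)[OF g] measurable_restrict_space1[OF borel_measurable_indicator]]) simp
      show "integrable ?M (\<lambda>x. \<bar>g x\<bar>)" using gi by simp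
      show "AE x in ?M. (\<lambda>n. g x * \<phi> n x) \<longlonglongrightarrow> g x * indicator (box c d) x"
        by (rule AE_I2) (auto intro!: tendsto_intros l)
      show "AE x in ?M. norm (g x * \<phi> n x) \<le> \<bar>g x\<bar>" for n
        using b by (intro AE_I2) (auto simp: abs_mult intro!: mult_left_le)
    qed measurable
    moreover have "(LINT x|?M. g x * \<phi> n x) = 0" for n
      using orth[OF t] by (simp add: l2_inner_def)
    ultimately show "(LINT x|?M. indicator (box c d) x * g x) = 0"
      using LIMSEQ_unique[OF _ tendsto_const] by (simp add: mult.commute)
  qed
  then show ?thesis by (simp add: ae_eq_def)
qed

section \<open>Weak divergence: uniqueness, linearity, and vanishing on curls\<close>

lemma is_weak_div_D:
  assumes "is_weak_div D v d"
  shows "d \<in> L2 (region D)"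
    "\<phi> \<in> test_functions D \<Longrightarrow> l2_inner (region D) v (\<lambda>x. \<chi> i. pderiv_at i \<phi> x) = - l2_inner (region D) d \<phi>"
  using assms by (auto simp: is_weak_div_def)

lemma is_weak_div_unique:
  assumes D: "valid_domain D" and d: "is_weak_div D v d" "is_weak_div D v d'"
  shows "ae_eq (region D) d d'"
proof -
  note dd = is_weak_div_D(1)[OF d(1)] is_weak_div_D(1)[OF d(2)]
  have "ae_eq (region D) (\<lambda>x. 1 *\<^sub>R d x + (- 1) *\<^sub>R d' x) (\<lambda>x. 0)"
  proof (rule l2_orthogonal_tensor_tests[OF D L2_lincomb[OF dd]])
    fix \<phi> assume "tensor_test D \<phi>"
    then have \<phi>: "\<phi> \<in> test_functions D" by (simp add: tensor_test_def)
    show "l2_inner (region D) (\<lambda>x. 1 *\<^sub>R d x + (- 1) *\<^sub>R d' x) \<phi> = 0"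
      unfolding l2_inner_lincomb[OF dd test_function_in_L2[OF D \<phi>]]
      using is_weak_div_D(2)[OF d(1) \<phi>] is_weak_div_D(2)[OF d(2) \<phi>] by simp
  qed
  then show ?thesis by (simp add: ae_eq_def)
qed

lemma is_weak_div_lincomb:
  assumes D: "valid_domain D" and vw: "v \<in> L2 (region D)" "w \<in> L2 (region D)"
    and d: "is_weak_div D v d" "is_weak_div D w d'"
  shows "is_weak_div D (\<lambda>x. \<alpha> *\<^sub>R v x + \<beta> *\<^sub>R w x) (\<lambda>x. \<alpha> *\<^sub>R d x + \<beta> *\<^sub>R d' x)"
  unfolding is_weak_div_def
proof (intro conjI ballI)
  note dd = is_weak_div_D(1)[OF d(1)] is_weak_div_D(1)[OF d(2)]
  show "(\<lambda>x. \<alpha> *\<^sub>R d x + \<beta> *\<^sub>R d' x) \<in> L2 (region D)" by (rule L2_lincomb[OF dd])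
  fix \<phi> assume \<phi>: "\<phi> \<in> test_functions D"
  show "l2_inner (region D) (\<lambda>x. \<alpha> *\<^sub>R v x + \<beta> *\<^sub>R w x) (\<lambda>x. \<chi> i. pderiv_at i \<phi> x) =
      - l2_inner (region D) (\<lambda>x. \<alpha> *\<^sub>R d x + \<beta> *\<^sub>R d' x) \<phi>"
    unfolding l2_inner_lincomb[OF dd test_function_in_L2[OF D \<phi>]]
      l2_inner_lincomb[OF vw test_function_grad_in_L2[OF D \<phi>]]
    using is_weak_div_D(2)[OF d(1) \<phi>] is_weak_div_D(2)[OF d(2) \<phi>] by simp
qed

lemma is_weak_div_cong:
  assumes D: "valid_domain D" and vw: "v \<in> L2 (region D)" "w \<in> L2 (region D)" "ae_eq (region D) v w"
    and d: "is_weak_div D v d"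
  shows "is_weak_div D w d"
proof -
  have "l2_inner (region D) v (\<lambda>x. \<chi> i. pderiv_at i \<phi> x) = l2_inner (region D) w (\<lambda>x. \<chi> i. pderiv_at i \<phi> x)"
    if "\<phi> \<in> test_functions D" for \<phi>
    by (intro l2_inner_cong vw ae_eq_refl test_function_grad_in_L2 D that)
  then show ?thesis using d by (simp add: is_weak_div_def)
qed

lemma Hdiv_D:
  assumes "v \<in> Hdiv D"
  shows "v \<in> L2 (region D)" "is_weak_div D v (weak_div D v)"
proof -
  show "v \<in> L2 (region D)" using assms by (simp add: Hdiv_def)
  have "\<exists>d. is_weak_div D v d" using assms by (simp add: Hdiv_def)
  then show "is_weak_div D v (weak_div D v)" unfolding weak_div_def by (rule someI_ex)
qed

text \<open>The explicit combination is a weak divergence, so the \<open>SOME\<close> on the left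
  has a witness, and uniqueness identifies its pick with that combination up to a null set.\<close>

lemma weak_div_lincomb:
  assumes D: "valid_domain D" and vw: "v \<in> Hdiv D" "w \<in> Hdiv D"
  shows "ae_eq (region D) (weak_div D (\<lambda>x. \<alpha> *\<^sub>R v x + \<beta> *\<^sub>R w x))
    (\<lambda>x. \<alpha> *\<^sub>R weak_div D v x + \<beta> *\<^sub>R weak_div D w x)"
proof -
  note d = is_weak_div_lincomb[OF D Hdiv_D(1)[OF vw(1)] Hdiv_D(1)[OF vw(2)] Hdiv_D(2)[OF vw(1)] Hdiv_D(2)[OF vw(2)]]
  show ?thesis
    unfolding weak_div_def[of D "\<lambda>x. \<alpha> *\<^sub>R v x + \<beta> *\<^sub>R w x"]
    by (rule is_weak_div_unique[OF D someI[of "is_weak_div D _"] d]) (rule d)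
qed

lemma weak_div_cong:
  assumes D: "valid_domain D" and vw: "v \<in> Hdiv D" "w \<in> Hdiv D" "ae_eq (region D) v w"
  shows "ae_eq (region D) (weak_div D v) (weak_div D w)"
  by (rule is_weak_div_unique[OF D _ Hdiv_D(2)[OF vw(2)]])
    (rule is_weak_div_cong[OF D Hdiv_D(1)[OF vw(1)] Hdiv_D(1)[OF vw(2)] vw(3) Hdiv_D(2)[OF vw(1)]])

lemma H1_D:
  assumes "\<omega> \<in> H1 D"
  shows "is_weak_pderiv D i \<omega> (weak_pderiv D i \<omega>)"
proof -
  have "\<exists>g. is_weak_pderiv D i \<omega> g" using assms by (simp add: H1_def)
  then show ?thesis unfolding weak_pderiv_def by (rule someI_ex)
qed

text \<open>Both derivatives are moved onto \<phi>, where the mixed partials cancel. Membership of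
  the curl in \<open>Hdiv D\<close> supplies a weak divergence; in the discrete complex it comes
  from the inclusion of curls in \<open>W1\<close>.\<close>

lemma weak_div_weak_curl:
  assumes D: "valid_domain D" and \<omega>: "\<omega> \<in> H1 D" and curl: "weak_curl D \<omega> \<in> Hdiv D"
  shows "ae_eq (region D) (weak_div D (weak_curl D \<omega>)) (\<lambda>x. 0)"
proof (rule l2_orthogonal_tensor_tests[OF D])
  note d = Hdiv_D(2)[OF curl]
  show "weak_div D (weak_curl D \<omega>) \<in> L2 (region D)" by (rule is_weak_div_D(1)[OF d])
  fix \<phi> assume tt: "tensor_test D \<phi>"
  then have \<phi>: "\<phi> \<in> test_functions D" by (simp add: tensor_test_def)
  note \<phi>' = pderiv_at_test_function[OF \<phi>]
  have w: "weak_pderiv D i \<omega> \<in> L2 (region D)" for i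
    using H1_D[OF \<omega>] by (simp add: is_weak_pderiv_def)
  have wp: "l2_inner (region D) (weak_pderiv D i \<omega>) \<psi> = - l2_inner (region D) \<omega> (pderiv_at i \<psi>)"
    if "\<psi> \<in> test_functions D" for i \<psi>
    using H1_D[OF \<omega>, of i] that by (auto simp: is_weak_pderiv_def)
  have int: "integrable (lebesgue_on (region D)) (\<lambda>x. weak_pderiv D i \<omega> x * pderiv_at j \<phi> x)" for i j
    using L2_inner_integrable[OF w test_function_in_L2[OF D \<phi>']] by simp
  have "l2_inner (region D) (weak_curl D \<omega>) (\<lambda>x. \<chi> i. pderiv_at i \<phi> x) =
      (LINT x|lebesgue_on (region D). weak_pderiv D 2 \<omega> x * pderiv_at 1 \<phi> x - weak_pderiv D 1 \<omega> x * pderiv_at 2 \<phi> x)"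
    by (simp add: l2_inner_def weak_curl_def inner_vec_def sum_2)
  also have "\<dots> = l2_inner (region D) (weak_pderiv D 2 \<omega>) (pderiv_at 1 \<phi>) - l2_inner (region D) (weak_pderiv D 1 \<omega>) (pderiv_at 2 \<phi>)"
    using int by (simp add: l2_inner_def)
  also have "\<dots> = 0"
    unfolding wp[OF \<phi>'] tensor_test_mixed_pderiv[OF tt] by simp
  finally show "l2_inner (region D) (weak_div D (weak_curl D \<omega>)) \<phi> = 0"
    using is_weak_div_D(2)[OF d \<phi>] by simp
qed

lemma V0_subset_H1: "V0 D \<subseteq> H1 D"
  by (cases D) auto

lemma V1_subset_Hdiv: "V1 D \<subseteq> Hdiv D"
  by (cases D) auto

lemma Hdiv_subset_L2: "Hdiv D \<subseteq> L2 (region D)"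
  by (auto simp: Hdiv_def)

lemma H1_subset_L2: "H1 D \<subseteq> L2 (region D)"
  by (auto simp: H1_def)

section \<open>The discrete complex\<close>

locale discrete_flow =
  fixes D W0 W1 W2
  assumes D: "valid_domain D" and complex: "discrete_complex D W0 W1 W2"
begin

abbreviation "\<Omega> \<equiv> region D"

lemma W0: "discrete_space \<Omega> (V0 D) W0" "V0 D \<subseteq> L2 \<Omega>"
  using complex V0_subset_H1[of D] H1_subset_L2[of D] by (auto simp: discrete_complex_def)

lemma W1: "discrete_space \<Omega> (V1 D) W1" "V1 D \<subseteq> L2 \<Omega>"
  using complex V1_subset_Hdiv[of D] Hdiv_subset_L2[of D] by (auto simp: discrete_complex_def)

lemma W2: "discrete_space \<Omega> (V2 D) W2" "V2 D \<subseteq> L2 \<Omega>"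
  using complex by (auto simp: discrete_complex_def V2_def)

sublocale W0: l2_subspace \<Omega> W0 by (rule discrete_space_l2_subspace[OF W0])
sublocale W1: l2_subspace \<Omega> W1 by (rule discrete_space_l2_subspace[OF W1])
sublocale W2: l2_subspace \<Omega> W2 by (rule discrete_space_l2_subspace[OF W2])

lemma W1_Hdiv: "v \<in> W1 \<Longrightarrow> v \<in> Hdiv D"
  using W1(1) V1_subset_Hdiv[of D] by (auto simp: discrete_space_def)

lemma W0_H1: "\<omega> \<in> W0 \<Longrightarrow> \<omega> \<in> H1 D"
  using W0(1) V0_subset_H1[of D] by (auto simp: discrete_space_def)

lemma weak_div_mem: "v \<in> W1 \<Longrightarrow> weak_div D v \<in> W2"
  using complex by (auto simp: discrete_complex_def)

lemma weak_curl_mem: "\<omega> \<in> W0 \<Longrightarrow> weak_curl D \<omega> \<in> W1"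
  using complex by (auto simp: discrete_complex_def)

text \<open>This releases the defining property from \<open>SOME\<close>. The Riesz lemma applies
  because the divergence is linear and independent of the representative, up to null sets.\<close>

lemma grad_h:
  assumes q: "q \<in> W2"
  shows "grad_h D W1 q \<in> W1"
    and "v \<in> W1 \<Longrightarrow> l2_inner \<Omega> (grad_h D W1 q) v = - l2_inner \<Omega> q (weak_div D v)"
proof -
  obtain E where E: "W1.orthonormal E" "W1 \<subseteq> W1.l2_span E"
    using discrete_space_orthonormal_basis[OF W1] by blast
  let ?F = "\<lambda>v. - l2_inner \<Omega> q (weak_div D v)"
  have "\<exists>g\<in>W1. \<forall>v\<in>W1. l2_inner \<Omega> g v = ?F v"
  proof (rule W1.Riesz[OF E])
    fix f g \<alpha> \<beta> assume f: "f \<in> W1" and g: "g \<in> W1"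
    note fd = W2.L2_mem[OF weak_div_mem[OF f]] and gd = W2.L2_mem[OF weak_div_mem[OF g]]
    have "l2_inner \<Omega> q (weak_div D (\<lambda>x. \<alpha> *\<^sub>R f x + \<beta> *\<^sub>R g x)) =
        l2_inner \<Omega> q (\<lambda>x. \<alpha> *\<^sub>R weak_div D f x + \<beta> *\<^sub>R weak_div D g x)"
      by (intro l2_inner_cong W2.L2_mem[OF q] ae_eq_refl weak_div_lincomb D W1_Hdiv f g L2_lincomb fd gd
          W2.L2_mem weak_div_mem W1.lincomb_mem)
    then show "?F (\<lambda>x. \<alpha> *\<^sub>R f x + \<beta> *\<^sub>R g x) = \<alpha> * ?F f + \<beta> * ?F g"
      using l2_inner_lincomb_right[OF fd gd W2.L2_mem[OF q]] by simp
  next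
    fix f g assume f: "f \<in> W1" and g: "g \<in> W1" and ae: "ae_eq \<Omega> f g"
    have "l2_inner \<Omega> q (weak_div D f) = l2_inner \<Omega> q (weak_div D g)"
      by (intro l2_inner_cong W2.L2_mem q ae_eq_refl weak_div_cong D W1_Hdiv f g ae weak_div_mem)
    then show "?F f = ?F g" by simp
  qed
  then have "\<exists>g. g \<in> W1 \<and> (\<forall>v\<in>W1. l2_inner \<Omega> g v = - l2_inner \<Omega> q (weak_div D v))" by blast
  from someI_ex[OF this] show "grad_h D W1 q \<in> W1"
    "v \<in> W1 \<Longrightarrow> l2_inner \<Omega> (grad_h D W1 q) v = - l2_inner \<Omega> q (weak_div D v)"
    unfolding grad_h_def by blast+
qed

text \<open>The zero function satisfies the condition under \<open>SOME\<close>, so the chosen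
  function is orthogonal to all of \<open>W0\<close>, and in particular to itself.\<close>

lemma curl_h_grad_h:
  assumes q: "q \<in> W2"
  shows "ae_eq \<Omega> (curl_h D W0 (grad_h D W1 q)) (\<lambda>x. 0)"
proof -
  have 0: "l2_inner \<Omega> (grad_h D W1 q) (weak_curl D \<omega>) = 0" if \<omega>: "\<omega> \<in> W0" for \<omega>
  proof -
    have "ae_eq \<Omega> (weak_div D (weak_curl D \<omega>)) (\<lambda>x. 0)"
      by (intro weak_div_weak_curl D W0_H1 W1_Hdiv weak_curl_mem \<omega>)
    then show ?thesis
      using grad_h(2)[OF q weak_curl_mem[OF \<omega>]] l2_inner_ae_zero(2) by simp
  qed
  have "l2_inner \<Omega> (\<lambda>x. 0) \<omega> = 0" for \<omega> :: "real^2 \<Rightarrow> real"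
    by (simp add: l2_inner_def)
  then have "\<exists>w. w \<in> W0 \<and> (\<forall>\<omega>\<in>W0. l2_inner \<Omega> w \<omega> = l2_inner \<Omega> (grad_h D W1 q) (weak_curl D \<omega>))"
    using W0.zero_mem 0 by (intro exI[of _ "\<lambda>x. 0"]) simp
  from someI_ex[OF this] have w: "curl_h D W0 (grad_h D W1 q) \<in> W0"
    "l2_inner \<Omega> (curl_h D W0 (grad_h D W1 q)) (curl_h D W0 (grad_h D W1 q)) = 0"
    unfolding curl_h_def using 0 by (blast, simp)
  then show ?thesis using l2_inner_self_eq_0 W0.L2_mem by blast
qed

text \<open>Orthonormality in \<open>W2\<close> expresses the norm of the divergence by its
  coefficients, and \<open>grad_h\<close> moves each coefficient onto \<open>v\<close>. The constant
  is the square root of \<open>S\<close>.\<close>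

lemma weak_div_bounded:
  obtains K where "\<And>v. v \<in> W1 \<Longrightarrow> l2_norm \<Omega> (weak_div D v) \<le> K * l2_norm \<Omega> v"
proof -
  obtain E where E: "W2.orthonormal E" "W2 \<subseteq> W2.l2_span E"
    using discrete_space_orthonormal_basis[OF W2] by blast
  have EW: "E \<subseteq> W2" using E(1) by (simp add: W2.orthonormal_def)
  define S where "S = (\<Sum>e\<in>E. l2_inner \<Omega> (grad_h D W1 e) (grad_h D W1 e))"
  have "l2_norm \<Omega> (weak_div D v) \<le> sqrt S * l2_norm \<Omega> v" if v: "v \<in> W1" for v
  proof -
    have "l2_inner \<Omega> (weak_div D v) (weak_div D v) = (\<Sum>e\<in>E. (l2_inner \<Omega> (weak_div D v) e)\<^sup>2)"
      by (rule W2.Parseval[OF E weak_div_mem[OF v]])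
    also have "\<dots> \<le> (\<Sum>e\<in>E. l2_inner \<Omega> (grad_h D W1 e) (grad_h D W1 e) * l2_inner \<Omega> v v)"
    proof (rule sum_mono)
      fix e assume "e \<in> E"
      then have e: "e \<in> W2" using EW by blast
      have "(l2_inner \<Omega> (weak_div D v) e)\<^sup>2 = (l2_inner \<Omega> (grad_h D W1 e) v)\<^sup>2"
        unfolding grad_h(2)[OF e v] by (simp add: l2_inner_commute)
      also have "\<dots> \<le> l2_inner \<Omega> (grad_h D W1 e) (grad_h D W1 e) * l2_inner \<Omega> v v"
        by (intro l2_Cauchy_Schwarz W1.L2_mem grad_h(1) e v)
      finally show "(l2_inner \<Omega> (weak_div D v) e)\<^sup>2 \<le>
          l2_inner \<Omega> (grad_h D W1 e) (grad_h D W1 e) * l2_inner \<Omega> v v" .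
    qed
    also have "\<dots> = S * l2_inner \<Omega> v v" by (simp add: S_def sum_distrib_right)
    finally show ?thesis by (simp add: l2_norm_def real_sqrt_mult[symmetric])
  qed
  then show ?thesis by (rule that)
qed

text \<open>The error of the difference quotient of the divergence is, almost everywhere, the
  divergence of the error for \<open>u\<close>, and that error lies in \<open>W1\<close>, where the
  bound applies.\<close>

lemma weak_div_time_derivative:
  assumes t: "t \<in> {0..T}" and u: "\<And>s. s \<in> {0..T} \<Longrightarrow> u s \<in> W1" and w: "w \<in> W1"
    and deriv: "has_time_derivative \<Omega> T u w t"
  shows "has_time_derivative \<Omega> T (\<lambda>s. weak_div D (u s)) (weak_div D w) t"
proof -
  obtain K where K: "\<And>v. v \<in> W1 \<Longrightarrow> l2_norm \<Omega> (weak_div D v) \<le> K * l2_norm \<Omega> v"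
    using weak_div_bounded by blast
  let ?d = "\<lambda>s x. (1 / (s - t)) *\<^sub>R (weak_div D (u s) x - weak_div D (u t) x) - weak_div D w x"
  let ?e = "\<lambda>s x. (1 / (s - t)) *\<^sub>R (u s x - u t x) - w x"
  \<comment> \<open>The case \<open>s = t\<close> needs no separate treatment: there
    \<open>1 / (s - t) = 0\<close>, and the same linear combination is used.\<close>
  have le: "l2_norm \<Omega> (?d s) \<le> K * l2_norm \<Omega> (?e s)" if s: "s \<in> {0..T}" for s
  proof -
    let ?k = "1 / (s - t)"
    let ?f = "\<lambda>x. ?k *\<^sub>R u s x + (- ?k) *\<^sub>R u t x"
    have f: "?f \<in> W1" by (intro W1.lincomb_mem u s t)
    have e: "(\<lambda>x. 1 *\<^sub>R ?f x + (- 1) *\<^sub>R w x) \<in> W1" by (intro W1.lincomb_mem[OF f w])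
    have eq: "(\<lambda>x. 1 *\<^sub>R ?f x + (- 1) *\<^sub>R w x) = ?e s" by (auto simp: algebra_simps)
    have "ae_eq \<Omega> (weak_div D ?f) (\<lambda>x. ?k *\<^sub>R weak_div D (u s) x + (- ?k) *\<^sub>R weak_div D (u t) x)"
      by (intro weak_div_lincomb D W1_Hdiv u s t)
    moreover have "ae_eq \<Omega> (weak_div D (?e s)) (\<lambda>x. 1 *\<^sub>R weak_div D ?f x + (- 1) *\<^sub>R weak_div D w x)"
      unfolding eq[symmetric] by (intro weak_div_lincomb D W1_Hdiv f w)
    ultimately have ae: "ae_eq \<Omega> (?d s) (weak_div D (?e s))"
      unfolding ae_eq_def by eventually_elim (simp add: algebra_simps)
    have e_div: "weak_div D (?e s) \<in> L2 \<Omega>"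
      using W2.L2_mem[OF weak_div_mem[OF e]] unfolding eq .
    have "?d s = (\<lambda>x. 1 *\<^sub>R (?k *\<^sub>R weak_div D (u s) x + (- ?k) *\<^sub>R weak_div D (u t) x) + (- 1) *\<^sub>R weak_div D w x)"
      by (auto simp: algebra_simps)
    also have "\<dots> \<in> L2 \<Omega>"
      by (intro L2_lincomb W2.L2_mem weak_div_mem u s t w)
    finally have "l2_norm \<Omega> (?d s) = l2_norm \<Omega> (weak_div D (?e s))"
      unfolding l2_norm_def by (intro arg_cong[of _ _ sqrt] l2_inner_cong e_div ae)
    then show ?thesis using K[OF e] unfolding eq by (simp only:)
  qed
  have "((\<lambda>s. K * l2_norm \<Omega> (?e s)) \<longlongrightarrow> K * 0) (at t within {0..T})"
    using deriv unfolding has_time_derivative_def by (intro tendsto_intros)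
  moreover have "\<forall>\<^sub>F s in at t within {0..T}. norm (l2_norm \<Omega> (?d s)) \<le> K * l2_norm \<Omega> (?e s)"
    unfolding eventually_at_filter
    by (rule always_eventually) (use le in \<open>auto simp: l2_norm_def l2_inner_self_nonneg\<close>)
  ultimately show ?thesis
    unfolding has_time_derivative_def mult_zero_right by (rule Lim_null_comparison[rotated])
qed

end

section \<open>Functions of time\<close>

text \<open>Used to replace the divergence of \<open>u' t\<close>, which is zero only almost
  everywhere, by the zero function itself.\<close>

lemma has_time_derivative_cong:
  assumes "ae_eq \<Omega> w w'"
    and "w \<in> L2 \<Omega>" "w' \<in> L2 \<Omega>" and u: "\<And>s. s \<in> {0..T} \<Longrightarrow> u s \<in> L2 \<Omega>" and "t \<in> {0..T}"
    and "has_time_derivative \<Omega> T u w t"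
  shows "has_time_derivative \<Omega> T u w' t"
proof -
  have L2: "(\<lambda>x. (1 / (s - t)) *\<^sub>R (u s x - u t x) - v x) \<in> L2 \<Omega>" if "s \<in> {0..T}" "v \<in> L2 \<Omega>" for s v
  proof -
    have "(\<lambda>x. (1 / (s - t)) *\<^sub>R (u s x - u t x) - v x) =
        (\<lambda>x. 1 *\<^sub>R ((1 / (s - t)) *\<^sub>R u s x + (- (1 / (s - t))) *\<^sub>R u t x) + (- 1) *\<^sub>R v x)"
      by (auto simp: algebra_simps)
    then show ?thesis
      by (simp only: L2_lincomb[OF L2_lincomb[OF u[OF that(1)] u[OF \<open>t \<in> {0..T}\<close>]] that(2)])
  qed
  have "\<forall>\<^sub>F s in at t within {0..T}. l2_norm \<Omega> (\<lambda>x. (1 / (s - t)) *\<^sub>R (u s x - u t x) - w x) =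
      l2_norm \<Omega> (\<lambda>x. (1 / (s - t)) *\<^sub>R (u s x - u t x) - w' x)"
    unfolding eventually_at_filter
  proof (rule always_eventually, intro allI impI)
    fix s assume s: "s \<in> {0..T}"
    have "ae_eq \<Omega> (\<lambda>x. (1 / (s - t)) *\<^sub>R (u s x - u t x) - w x) (\<lambda>x. (1 / (s - t)) *\<^sub>R (u s x - u t x) - w' x)"
      using assms(1) unfolding ae_eq_def by eventually_elim simp
    then show "l2_norm \<Omega> (\<lambda>x. (1 / (s - t)) *\<^sub>R (u s x - u t x) - w x) =
        l2_norm \<Omega> (\<lambda>x. (1 / (s - t)) *\<^sub>R (u s x - u t x) - w' x)"
      unfolding l2_norm_def by (intro arg_cong[of _ _ sqrt] l2_inner_cong L2 s assms)
  qed
  from Lim_transform_eventually[OF assms(6)[unfolded has_time_derivative_def] this]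
  show ?thesis unfolding has_time_derivative_def .
qed

text \<open>By Cauchy-Schwarz the scalar difference quotients are bounded by the L2 norm of those of
  \<open>f\<close>, so the scalar function has derivative 0 on an interval.\<close>

lemma l2_inner_constant_in_time:
  fixes f :: "real \<Rightarrow> real^2 \<Rightarrow> 'b::euclidean_space"
  assumes f: "\<And>t. t \<in> {0..T} \<Longrightarrow> f t \<in> L2 \<Omega>" and q: "q \<in> L2 \<Omega>"
    and deriv: "\<And>t. t \<in> {0..T} \<Longrightarrow> has_time_derivative \<Omega> T f (\<lambda>x. 0) t"
    and t: "t \<in> {0..T}"
  shows "l2_inner \<Omega> (f t) q = l2_inner \<Omega> (f 0) q"
proof -
  have "((\<lambda>s. l2_inner \<Omega> (f s) q) has_real_derivative 0) (at r within {0..T})" if r: "r \<in> {0..T}" for r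
  proof -
    have le: "norm ((l2_inner \<Omega> (f s) q - l2_inner \<Omega> (f r) q) / (s - r)) \<le>
        l2_norm \<Omega> (\<lambda>x. (1 / (s - r)) *\<^sub>R (f s x - f r x) - 0) * l2_norm \<Omega> q" if s: "s \<in> {0..T}" for s
    proof -
      let ?k = "1 / (s - r)"
      have eq: "(\<lambda>x. ?k *\<^sub>R (f s x - f r x) - 0) = (\<lambda>x. ?k *\<^sub>R f s x + (- ?k) *\<^sub>R f r x)"
        by (auto simp: algebra_simps)
      have "(l2_inner \<Omega> (f s) q - l2_inner \<Omega> (f r) q) / (s - r) =
          l2_inner \<Omega> (\<lambda>x. ?k *\<^sub>R f s x + (- ?k) *\<^sub>R f r x) q"
        unfolding l2_inner_lincomb[OF f[OF s] f[OF r] q] by (simp add: diff_divide_distrib)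
      then show ?thesis
        unfolding eq real_norm_def by (simp only: l2_inner_abs_le[OF L2_lincomb[OF f[OF s] f[OF r]] q])
    qed
    have "((\<lambda>s. l2_norm \<Omega> (\<lambda>x. (1 / (s - r)) *\<^sub>R (f s x - f r x) - 0) * l2_norm \<Omega> q) \<longlongrightarrow> 0 * l2_norm \<Omega> q)
        (at r within {0..T})"
      by (rule tendsto_mult[OF deriv[OF r, unfolded has_time_derivative_def] tendsto_const])
    moreover have "\<forall>\<^sub>F s in at r within {0..T}. norm ((l2_inner \<Omega> (f s) q - l2_inner \<Omega> (f r) q) / (s - r)) \<le>
        l2_norm \<Omega> (\<lambda>x. (1 / (s - r)) *\<^sub>R (f s x - f r x) - 0) * l2_norm \<Omega> q"
      unfolding eventually_at_filter by (rule always_eventually) (use le in blast)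
    ultimately have "((\<lambda>s. (l2_inner \<Omega> (f s) q - l2_inner \<Omega> (f r) q) / (s - r)) \<longlongrightarrow> 0) (at r within {0..T})"
      unfolding mult_zero_left by (rule Lim_null_comparison[rotated])
    then show ?thesis
      unfolding has_field_derivative_iff .
  qed
  then obtain c where "\<And>s. s \<in> {0..T} \<Longrightarrow> l2_inner \<Omega> (f s) q = c"
    using has_field_derivative_zero_constant[of "{0..T}" "\<lambda>s. l2_inner \<Omega> (f s) q"] by auto
  then show ?thesis using t by simp
qed

section \<open>Conservation of the discrete divergence\<close>

theorem proposition4:
  fixes D :: flow_domain
    and V0h V2h :: "(real^2 \<Rightarrow> real) set"
    and V1h :: "(real^2 \<Rightarrow> real^2) set"
    and \<nu> T :: real
    and u u' :: "real \<Rightarrow> real^2 \<Rightarrow> real^2"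
    and p :: "real \<Rightarrow> real^2 \<Rightarrow> real"
  assumes "valid_domain D"
    and "discrete_complex D V0h V1h V2h"
    and "\<nu> \<ge> 0" and "T > 0"
    and "\<forall>t\<in>{0..T}. u t \<in> V1h \<and> p t \<in> V2h"
    and "\<forall>t\<in>{0..T}. u' t \<in> V1h \<and> has_time_derivative (region D) T u (u' t) t"
    and "l2_continuous (region D) T u'"
    and "\<forall>t\<in>{0..T}. \<forall>v\<in>V1h.
           l2_inner (region D) (u' t) v
         + l2_inner (region D) (u t) (s_h D V1h V2h (u t) v)
         + l2_inner (region D) (grad_h D V1h (p t)) v
         + \<nu> * l2_inner (region D) (curl_h D V0h (u t)) (curl_h D V0h v) = 0"
    and "\<forall>t\<in>{0..T}. \<forall>q\<in>V2h.
           l2_inner (region D) (u t) (s_h D V1h V2h (u t) (grad_h D V1h q))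
         + l2_inner (region D) (grad_h D V1h (p t)) (grad_h D V1h q) = 0"
  shows "(\<forall>t\<in>{0..T}. has_time_derivative (region D) T (\<lambda>s. weak_div D (u s)) (\<lambda>x. 0) t) \<and>
         (ae_eq (region D) (weak_div D (u 0)) (\<lambda>x. 0) \<longrightarrow>
           (\<forall>t\<in>{0..T}. ae_eq (region D) (weak_div D (u t)) (\<lambda>x. 0)))"
proof -
  interpret discrete_flow D V0h V1h V2h by standard (rule assms)+
  have u: "u t \<in> V1h" and u': "u' t \<in> V1h" "has_time_derivative \<Omega> T u (u' t) t" if "t \<in> {0..T}" for t
    using that assms(5,6) by auto
  note div_u = W2.L2_mem[OF weak_div_mem[OF u]]
  have div_u': "ae_eq \<Omega> (weak_div D (u' t)) (\<lambda>x. 0)" if t: "t \<in> {0..T}" for t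
  proof (rule l2_inner_self_eq_0)
    let ?q = "weak_div D (u' t)"
    have q: "?q \<in> V2h" by (rule weak_div_mem[OF u'(1)[OF t]])
    have "l2_inner \<Omega> (u' t) (grad_h D V1h ?q)
         + l2_inner \<Omega> (u t) (s_h D V1h V2h (u t) (grad_h D V1h ?q))
         + l2_inner \<Omega> (grad_h D V1h (p t)) (grad_h D V1h ?q)
         + \<nu> * l2_inner \<Omega> (curl_h D V0h (u t)) (curl_h D V0h (grad_h D V1h ?q)) = 0"
      using assms(8) t grad_h(1)[OF q] by blast
    \<comment> \<open>The null factor alone settles this; no property of
      \<open>curl_h D V0h (u t)\<close> has to be derived.\<close>
    moreover have "l2_inner \<Omega> (curl_h D V0h (u t)) (curl_h D V0h (grad_h D V1h ?q)) = 0"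
      by (rule l2_inner_ae_zero(2)[OF curl_h_grad_h[OF q]])
    moreover have "l2_inner \<Omega> (u t) (s_h D V1h V2h (u t) (grad_h D V1h ?q))
         + l2_inner \<Omega> (grad_h D V1h (p t)) (grad_h D V1h ?q) = 0"
      using assms(9) t q by blast
    ultimately have "l2_inner \<Omega> (u' t) (grad_h D V1h ?q) = 0" by simp
    then show "l2_inner \<Omega> ?q ?q = 0"
      using grad_h(2)[OF q u'(1)[OF t]] by (simp add: l2_inner_commute[of \<Omega> "u' t"])
    show "?q \<in> L2 \<Omega>" by (rule W2.L2_mem[OF q])
  qed
  have deriv: "has_time_derivative \<Omega> T (\<lambda>s. weak_div D (u s)) (\<lambda>x. 0) t" if t: "t \<in> {0..T}" for t
    by (rule has_time_derivative_cong[OF div_u'[OF t] W2.L2_mem[OF weak_div_mem[OF u'(1)[OF t]]]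
          W2.L2_mem[OF W2.zero_mem] div_u t weak_div_time_derivative[OF t u u'[OF t]]])
  moreover have "ae_eq \<Omega> (weak_div D (u t)) (\<lambda>x. 0)"
    if "ae_eq \<Omega> (weak_div D (u 0)) (\<lambda>x. 0)" and t: "t \<in> {0..T}" for t
  proof (rule l2_inner_self_eq_0[OF div_u[OF t]])
    \<comment> \<open>The fixed function paired with is the divergence at the final time
      \<open>t\<close>, so constancy links its squared norm to the initial divergence.\<close>
    have "l2_inner \<Omega> (weak_div D (u t)) (weak_div D (u t)) = l2_inner \<Omega> (weak_div D (u 0)) (weak_div D (u t))"
      by (rule l2_inner_constant_in_time[OF div_u div_u[OF t] deriv t])
    then show "l2_inner \<Omega> (weak_div D (u t)) (weak_div D (u t)) = 0"
      using l2_inner_ae_zero(1)[OF that(1)] by simp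
  qed
  ultimately show ?thesis by blast
qed

end
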